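(* Within the pseudovariety $\mathsf M$ of all finite monoids, each of the sets of pseudoidentities $\Sigma=\{x^{\omega+1}=x^\omega,\ (xy)^\omega(yx)^\omega(xy)^\omega=(xy)^\omega\}$ and $\Gamma=\{((xy)^\omega x)^2=(xy)^\omega x\}$ is h-strong.
   Context: $\mathsf M$ is the pseudovariety of finite monoids (signature: multiplication and $1$); $\Omega_A\mathsf M$ is the free profinite monoid on a finite set $A$. In a profinite monoid $x^\omega=\lim x^{n!}$ and $x^{\omega+1}=x^\omega x$. An $\mathsf M$-pseudoidentity is $u=v$ with $u,v\in\Omega_B\mathsf M$, $B$ finite; it holds in a finite monoid $T$ if both sides agree under every continuous homomorphism $\Omega_B\mathsf M\to T$; $[\![\Sigma]\!]$ is the class of finite monoids satisfying $\Sigma$. Provability: for finite $A$, $\Sigma_0\subseteq\Omega_A\mathsf M\times\Omega_A\mathsf M$ is the set of pairs $(\mathbf t(\varphi(u),w_1,\dots,w_n),\mathbf t(\varphi(v),w_1,\dots,w_n))$ with $u=v$ or $v=u$ in $\Sigma$ ($u,v\in\Omega_B\mathsf M$), $\varphi:\Omega_B\mathsf M\to\Omega_A\mathsf M$ a continuous homomorphism, $\mathbf t$ a monoid term, $w_i\in\Omega_A\mathsf M$; $\Sigma_{2\alpha+1}$ is the transitive closure of $\Sigma_{2\alpha}$, $\Sigma_{2\alpha+2}$ the topological closure of $\Sigma_{2\alpha+1}$, unions at limit ordinals; $u=v$ is provable from $\Sigma$ if $(u,v)\in\bigcup_\alpha\Sigma_\alpha$. A set $\Sigma$ is h-strong within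 $\mathsf M$ if every $\mathsf M$-pseudoidentity valid in $[\![\Sigma]\!]$ is provable from $\Sigma$. *)

theory Defs
  imports "HOL-Analysis.Analysis" "HOL-Algebra.Group"
begin

text \<open>Finite monoids are represented by HOL-Algebra monoid structures with carrier a
finite subset of nat (every finite monoid is isomorphic to such a one).\<close>

definition fin_monoid :: "nat monoid \<Rightarrow> bool" where
  "fin_monoid T \<longleftrightarrow> monoid T \<and> finite (carrier T)"

definition mon_hom :: "nat monoid \<Rightarrow> nat monoid \<Rightarrow> (nat \<Rightarrow> nat) set" where
  "mon_hom T S = {h. h \<in> carrier T \<rightarrow> carrier S \<and> h \<one>\<^bsub>T\<^esub> = \<one>\<^bsub>S\<^esub> \<and>
      (\<forall>x\<in>carrier T. \<forall>y\<in>carrier T. h (x \<otimes>\<^bsub>T\<^esub> y) = h x \<otimes>\<^bsub>S\<^esub> h y)}"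

section \<open>The free profinite monoid \<Omega>_A M as the monoid of A-ary implicit operations\<close>

type_synonym test = "nat monoid \<times> (nat \<Rightarrow> nat)"
type_synonym pw = "test \<Rightarrow> nat"

definition tests :: "nat set \<Rightarrow> test set" where
  "tests A = {(T, \<phi>). fin_monoid T \<and> \<phi> \<in> A \<rightarrow>\<^sub>E carrier T}"

definition Omega :: "nat set \<Rightarrow> pw set" where
  "Omega A = {w \<in> (\<Pi>\<^sub>E p\<in>tests A. UNIV).
     \<forall>T \<phi>. (T, \<phi>) \<in> tests A \<longrightarrow> w (T, \<phi>) \<in> carrier T \<and>
        (\<forall>S h. fin_monoid S \<longrightarrow> h \<in> mon_hom T S \<longrightarrow>
               h (w (T, \<phi>)) = w (S, restrict (h \<circ> \<phi>) A))}"

definition OmegaTop :: "nat set \<Rightarrow> pw topology" where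
  "OmegaTop A = subtopology (product_topology (\<lambda>_. discrete_topology UNIV) (tests A)) (Omega A)"

definition omult :: "nat set \<Rightarrow> pw \<Rightarrow> pw \<Rightarrow> pw" where
  "omult A u v = (\<lambda>p\<in>tests A. u p \<otimes>\<^bsub>fst p\<^esub> v p)"

definition oone :: "nat set \<Rightarrow> pw" where
  "oone A = (\<lambda>p\<in>tests A. \<one>\<^bsub>fst p\<^esub>)"

definition gen :: "nat set \<Rightarrow> nat \<Rightarrow> pw" where
  "gen A a = (\<lambda>p\<in>tests A. snd p a)"

primrec opow :: "nat set \<Rightarrow> pw \<Rightarrow> nat \<Rightarrow> pw" where
  "opow A x 0 = oone A"
| "opow A x (Suc n) = omult A x (opow A x n)"

definition omega_pow :: "nat set \<Rightarrow> pw \<Rightarrow> pw" where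
  "omega_pow A x = (THE y. limitin (OmegaTop A) (\<lambda>n. opow A x (fact n)) y sequentially)"

definition cont_hom :: "nat set \<Rightarrow> nat set \<Rightarrow> (pw \<Rightarrow> pw) \<Rightarrow> bool" where
  "cont_hom B A f \<longleftrightarrow> continuous_map (OmegaTop B) (OmegaTop A) f \<and>
     f (oone B) = oone A \<and>
     (\<forall>u\<in>Omega B. \<forall>v\<in>Omega B. f (omult B u v) = omult A (f u) (f v))"

definition cont_hom_to :: "nat set \<Rightarrow> nat monoid \<Rightarrow> (pw \<Rightarrow> nat) \<Rightarrow> bool" where
  "cont_hom_to B T h \<longleftrightarrow> continuous_map (OmegaTop B) (discrete_topology (carrier T)) h \<and>
     h (oone B) = \<one>\<^bsub>T\<^esub> \<and>
     (\<forall>u\<in>Omega B. \<forall>v\<in>Omega B. h (omult B u v) = h u \<otimes>\<^bsub>T\<^esub> h v)"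

type_synonym pid = "nat set \<times> pw \<times> pw"

definition is_pid :: "pid \<Rightarrow> bool" where
  "is_pid e \<longleftrightarrow> (case e of (B, u, v) \<Rightarrow> finite B \<and> u \<in> Omega B \<and> v \<in> Omega B)"

definition holds_in :: "pid \<Rightarrow> nat monoid \<Rightarrow> bool" where
  "holds_in e T \<longleftrightarrow> (case e of (B, u, v) \<Rightarrow> \<forall>h. cont_hom_to B T h \<longrightarrow> h u = h v)"

definition models :: "pid set \<Rightarrow> nat monoid set" where
  "models \<Sigma> = {T. fin_monoid T \<and> (\<forall>e\<in>\<Sigma>. holds_in e T)}"

datatype mterm = MVar nat | MOne | MMul mterm mterm

primrec eval_mterm :: "nat set \<Rightarrow> (nat \<Rightarrow> pw) \<Rightarrow> mterm \<Rightarrow> pw" where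
  "eval_mterm A val (MVar i) = val i"
| "eval_mterm A val MOne = oone A"
| "eval_mterm A val (MMul s t) = omult A (eval_mterm A val s) (eval_mterm A val t)"

text \<open>\<Sigma>_0 over alphabet A: t(\<phi>(u), w_1, ..., w_n) with variable 0 standing for the
first argument and variables i \<ge> 1 for the w_i.\<close>
definition Sigma0 :: "pid set \<Rightarrow> nat set \<Rightarrow> (pw \<times> pw) set" where
  "Sigma0 \<Sigma> A = {(eval_mterm A (w(0 := f u)) t, eval_mterm A (w(0 := f v)) t) | B u v f t w.
      ((B, u, v) \<in> \<Sigma> \<or> (B, v, u) \<in> \<Sigma>) \<and> cont_hom B A f \<and> (\<forall>i. w i \<in> Omega A)}"

text \<open>The union over all ordinals of the transfinite iteration (alternately transitive closure
and topological closure) starting at \<Sigma>_0 is the least relation containing \<Sigma>_0 that is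
transitive and topologically closed in \<Omega>_A M \<times> \<Omega>_A M.\<close>
definition Provable :: "pid set \<Rightarrow> nat set \<Rightarrow> (pw \<times> pw) set" where
  "Provable \<Sigma> A = \<Inter>{R. Sigma0 \<Sigma> A \<subseteq> R \<and> R O R \<subseteq> R \<and>
      (prod_topology (OmegaTop A) (OmegaTop A)) closure_of R \<subseteq> R}"

definition h_strong :: "pid set \<Rightarrow> bool" where
  "h_strong \<Sigma> \<longleftrightarrow> (\<forall>A u v. finite A \<longrightarrow> u \<in> Omega A \<longrightarrow> v \<in> Omega A \<longrightarrow>
      (\<forall>T\<in>models \<Sigma>. holds_in (A, u, v) T) \<longrightarrow> (u, v) \<in> Provable \<Sigma> A)"

definition XY :: "nat set" where "XY = {0, 1}"
definition gx :: pw where "gx = gen XY 0"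
definition gy :: pw where "gy = gen XY 1"

definition SigmaSet :: "pid set" where
  "SigmaSet = {(XY, omult XY (omega_pow XY gx) gx, omega_pow XY gx),
     (XY, omult XY (omult XY (omega_pow XY (omult XY gx gy)) (omega_pow XY (omult XY gy gx)))
                   (omega_pow XY (omult XY gx gy)),
          omega_pow XY (omult XY gx gy))}"

definition GammaSet :: "pid set" where
  "GammaSet = (let z = omult XY (omega_pow XY (omult XY gx gy)) gx in {(XY, omult XY z z, z)})"

end

theory Submission
  imports Defs "HOL-Library.Nat_Bijection"
begin

text \<open>Both sets define the pseudovariety DA.  Provability from either of them is a closed congruence
  on the free profinite monoid, and in its quotient every idempotent \<open>e\<close> satisfies
  \<open>e x e = e\<close> as soon as the content of \<open>x\<close> is contained in that of \<open>e\<close>.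
  This alone forces two implicit operations \<open>u\<close>, \<open>v\<close> that agree on DA to have equal images.
  By induction on the content \<open>C\<close>, factor \<open>u\<close> and \<open>v\<close> at the letter that occurs
  for the first time last, and iterate on the right-hand factors; the factorizations of \<open>u\<close>
  and \<open>v\<close> match because finite monoids in DA detect first occurrences.  If the content drops at
  some step, the induction hypothesis applies.  Otherwise compactness gives \<open>u = x u'\<close>,
  \<open>v = y v'\<close> with \<open>x\<close>, \<open>y\<close> identified in the quotient and
  \<open>x = x z\<close> for some \<open>z\<close> of content \<open>C\<close>.  The dual argument gives a suffix
  \<open>x'\<close> common to \<open>u\<close> and \<open>v\<close>, and in the quotient both are equal to
  \<open>x x'\<close>.\<close>

text \<open>A priori the quotient by provability need not be residually finite, so its identities
  cannot be checked in finite images. Only its multiplication and the closedness of its kernel are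
  available. Every identity in it is therefore either an algebraic computation or a limit of
  identities between approximating elements. Validity on all models of a basis is exploited only
  through the finite monoids \<open>Q A n\<close>, quotients of the word monoid by a filtration in
  which splitting at a first or last occurrence costs one level of \<open>n\<close>. Agreement in
  all \<open>Q A n\<close> thus survives arbitrarily many splits. That \<open>Q A n\<close>
  satisfies both bases rests on pumping: more than \<open>n\<close> copies of a word on either side
  hide whatever stands between them over the same letters. Tests are directed by how finely they
  separate implicit operations, and one test already describes a neighbourhood. Compactness is
  therefore used through nets indexed by tests: an equation that holds at test \<open>q\<close> in
  the \<open>q\<close>-th approximation becomes exact at a cluster point.\<close>

lemma tests_iff: "(T, \<phi>) \<in> tests A \<longleftrightarrow> fin_monoid T \<and> \<phi> \<in> A \<rightarrow>\<^sub>E carrier T"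
  by (simp add: tests_def)

lemma tests_monoid: "p \<in> tests A \<Longrightarrow> monoid (fst p)"
  by (cases p) (simp add: tests_iff fin_monoid_def)

lemma tests_finite: "p \<in> tests A \<Longrightarrow> finite (carrier (fst p))"
  by (cases p) (simp add: tests_iff fin_monoid_def)

lemma Omega_carrier: "u \<in> Omega A \<Longrightarrow> p \<in> tests A \<Longrightarrow> u p \<in> carrier (fst p)"
  by (cases p) (auto simp: Omega_def)

lemma Omega_extensional: "u \<in> Omega A \<Longrightarrow> u \<in> extensional (tests A)"
  by (simp add: Omega_def PiE_def)

lemma Omega_natural:
  "\<lbrakk>u \<in> Omega A; (T, \<phi>) \<in> tests A; fin_monoid S; h \<in> mon_hom T S\<rbrakk>
    \<Longrightarrow> h (u (T, \<phi>)) = u (S, restrict (h \<circ> \<phi>) A)"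
  by (simp add: Omega_def)

lemma OmegaI:
  assumes "u \<in> extensional (tests A)"
    and "\<And>T \<phi>. (T, \<phi>) \<in> tests A \<Longrightarrow> u (T, \<phi>) \<in> carrier T"
    and "\<And>T \<phi> S h. \<lbrakk>(T, \<phi>) \<in> tests A; fin_monoid S; h \<in> mon_hom T S\<rbrakk>
      \<Longrightarrow> h (u (T, \<phi>)) = u (S, restrict (h \<circ> \<phi>) A)"
  shows "u \<in> Omega A"
  using assms by (simp add: Omega_def PiE_def)

lemma Omega_eqI:
  "\<lbrakk>u \<in> Omega A; v \<in> Omega A; \<And>p. p \<in> tests A \<Longrightarrow> u p = v p\<rbrakk> \<Longrightarrow> u = v"
  by (meson Omega_extensional extensionalityI)

lemma mon_hom_tests:
  assumes "(T, \<phi>) \<in> tests A" "fin_monoid S" "h \<in> mon_hom T S"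
  shows "(S, restrict (h \<circ> \<phi>) A) \<in> tests A"
  using assms by (auto simp: tests_iff mon_hom_def PiE_iff Pi_iff)

lemma omult_apply [simp]: "p \<in> tests A \<Longrightarrow> omult A u v p = u p \<otimes>\<^bsub>fst p\<^esub> v p"
  by (simp add: omult_def)

lemma oone_apply [simp]: "p \<in> tests A \<Longrightarrow> oone A p = \<one>\<^bsub>fst p\<^esub>"
  by (simp add: oone_def)

lemma gen_apply [simp]: "p \<in> tests A \<Longrightarrow> gen A a p = snd p a"
  by (simp add: gen_def)

lemma omult_closed [simp]:
  assumes "u \<in> Omega A" "v \<in> Omega A" shows "omult A u v \<in> Omega A"
proof (rule OmegaI)
  show "omult A u v \<in> extensional (tests A)" by (simp add: omult_def)
next
  fix T \<phi> assume t: "(T, \<phi>) \<in> tests A"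
  then show "omult A u v (T, \<phi>) \<in> carrier T"
    using monoid.m_closed[of T] tests_monoid[OF t] Omega_carrier[OF assms(1) t] Omega_carrier[OF assms(2) t] by simp
next
  fix T \<phi> S h assume t: "(T, \<phi>) \<in> tests A" and S: "fin_monoid S" and h: "h \<in> mon_hom T S"
  show "h (omult A u v (T, \<phi>)) = omult A u v (S, restrict (h \<circ> \<phi>) A)"
    using Omega_natural[OF assms(1) t S h] Omega_natural[OF assms(2) t S h]
      Omega_carrier[OF assms(1) t] Omega_carrier[OF assms(2) t] t mon_hom_tests[OF t S h] h
    by (simp add: mon_hom_def)
qed

lemma oone_closed [simp]: "oone A \<in> Omega A"
  by (rule OmegaI) (auto simp: mon_hom_tests mon_hom_def oone_def dest: tests_monoid intro: monoid.one_closed)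

lemma gen_closed [simp]: "a \<in> A \<Longrightarrow> gen A a \<in> Omega A"
  by (rule OmegaI) (auto simp: mon_hom_tests gen_def dest: mon_hom_tests, auto simp: tests_iff)

lemma omult_assoc:
  assumes "u \<in> Omega A" "v \<in> Omega A" "w \<in> Omega A"
  shows "omult A (omult A u v) w = omult A u (omult A v w)"
proof (rule Omega_eqI)
  fix p assume p: "p \<in> tests A"
  show "omult A (omult A u v) w p = omult A u (omult A v w) p"
    using p monoid.m_assoc[OF tests_monoid[OF p] assms[THEN Omega_carrier, OF p]] by simp
qed (use assms in auto)

lemma omult_one_left [simp]: "u \<in> Omega A \<Longrightarrow> omult A (oone A) u = u"
  using monoid.l_one[OF tests_monoid Omega_carrier] by (intro Omega_eqI) auto

lemma omult_one_right [simp]: "u \<in> Omega A \<Longrightarrow> omult A u (oone A) = u"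
  using monoid.r_one[OF tests_monoid Omega_carrier] by (intro Omega_eqI) auto

lemma opow_closed [simp]: "x \<in> Omega A \<Longrightarrow> opow A x n \<in> Omega A"
  by (induction n) auto

lemma opow_apply:
  assumes x: "x \<in> Omega A" and p: "p \<in> tests A"
  shows "opow A x n p = x p [^]\<^bsub>fst p\<^esub> n"
proof (induction n)
  case 0 show ?case using p by simp
next
  case (Suc n)
  then show ?case
    using p monoid.nat_pow_Suc2[OF tests_monoid[OF p] Omega_carrier[OF x p]] by simp
qed

section \<open>Factorial powers in a finite monoid\<close>

lemma (in monoid) finite_pow_fact:
  assumes fin: "finite (carrier G)" and x: "x \<in> carrier G"
  obtains m0 where "\<And>m. m \<ge> m0 \<Longrightarrow> x [^] (fact m :: nat) = x [^] (fact m0 :: nat)"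
    "x [^] (fact m0 :: nat) \<otimes> x [^] (fact m0 :: nat) = x [^] (fact m0 :: nat)"
proof -
  have "\<not> inj (\<lambda>n::nat. x [^] n)"
    using finite_imageD[of "\<lambda>n::nat. x [^] n" UNIV] finite_subset[OF _ fin, of "range (\<lambda>n::nat. x [^] n)"] x
    by auto
  then obtain i j :: nat where ij: "i < j" "x [^] i = x [^] j"
    unfolding inj_def by (metis nat_neq_iff)
  define d where "d = j - i"
  have d: "d > 0" "x [^] i = x [^] (i + d)" using ij by (auto simp: d_def)
  have step: "x [^] (k + d) = x [^] k" if "k \<ge> i" for k
  proof -
    have "x [^] (k + d) = x [^] (i + d) \<otimes> x [^] (k - i)"
      using that x by (simp add: nat_pow_mult add.commute)
    also have "\<dots> = x [^] k" using that x unfolding d(2)[symmetric] by (simp add: nat_pow_mult)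
    finally show ?thesis .
  qed
  have steps: "x [^] (k + c * d) = x [^] k" if "k \<ge> i" for k c
  proof (induction c)
    case (Suc c)
    have "x [^] (k + c * d + d) = x [^] (k + c * d)" using step that by simp
    then show ?case using Suc by (simp add: algebra_simps)
  qed simp
  have mult: "x [^] (k + l) = x [^] k" if "k \<ge> i" "d dvd l" for k l
    using steps[OF that(1)] that(2) by (auto simp: dvd_def mult.commute)
  \<comment> \<open>Both the index \<open>i\<close> and the period \<open>d\<close> are at most
    \<open>m0\<close>, so the factorial of \<open>m0\<close> is beyond the index and divisible by
    the period.\<close>
  define m0 where "m0 = i + d"
  have ge: "(fact m0 :: nat) \<ge> i" using fact_ge_self[of m0] by (simp add: m0_def)
  have dvd: "d dvd (fact m0 :: nat)" using d(1) by (intro dvd_fact) (auto simp: m0_def)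
  show ?thesis
  proof (rule that)
    fix m assume "m \<ge> m0"
    then have "(fact m :: nat) \<ge> fact m0" "(fact m0 :: nat) dvd fact m" by (auto intro: fact_mono_nat fact_dvd)
    then have "d dvd (fact m - fact m0 :: nat)" using dvd by (meson dvd_diff_nat dvd_trans)
    then show "x [^] (fact m :: nat) = x [^] (fact m0 :: nat)"
      using mult[OF ge, of "fact m - fact m0"] \<open>(fact m :: nat) \<ge> fact m0\<close> by simp
  next
    show "x [^] (fact m0 :: nat) \<otimes> x [^] (fact m0 :: nat) = x [^] (fact m0 :: nat)"
      using mult[OF ge dvd] x by (simp add: nat_pow_mult)
  qed
qed

section \<open>Directedness of the tests and density of the words\<close>

text \<open>A preorder on tests by refinement of kernels. It is directed, so finitely many
  coordinates can be controlled by a single test.\<close>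

definition dominates :: "nat set \<Rightarrow> test \<Rightarrow> test \<Rightarrow> bool" where
  "dominates A q p \<longleftrightarrow> (\<forall>u\<in>Omega A. \<forall>v\<in>Omega A. u q = v q \<longrightarrow> u p = v p)"

lemma dominatesD: "\<lbrakk>dominates A q p; u q = v q; u \<in> Omega A; v \<in> Omega A\<rbrakk> \<Longrightarrow> u p = v p"
  by (auto simp: dominates_def)

lemma dominates_trans: "dominates A r q \<Longrightarrow> dominates A q p \<Longrightarrow> dominates A r p"
  by (auto simp: dominates_def)

lemma dominates_mon_hom:
  assumes "(T, \<phi>) \<in> tests A" "fin_monoid S" "h \<in> mon_hom T S" "restrict (h \<circ> \<phi>) A = \<psi>"
  shows "dominates A (T, \<phi>) (S, \<psi>)"
  unfolding dominates_def using Omega_natural[OF _ assms(1-3)] assms(4) by metis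

text \<open>The product of the two monoids dominates both through its projections. Pairs are encoded
  as numbers because carriers must consist of naturals.\<close>

lemma dominates_pair:
  assumes p: "p \<in> tests A" and q: "q \<in> tests A"
  obtains r where "r \<in> tests A" "dominates A r p" "dominates A r q"
proof -
  obtain T \<phi> where p': "p = (T, \<phi>)" by (cases p)
  obtain S \<psi> where q': "q = (S, \<psi>)" by (cases q)
  have T: "fin_monoid T" "\<phi> \<in> A \<rightarrow>\<^sub>E carrier T" and S: "fin_monoid S" "\<psi> \<in> A \<rightarrow>\<^sub>E carrier S"
    using p q by (auto simp: p' q' tests_iff)
  interpret T: monoid T using T by (simp add: fin_monoid_def)
  interpret S: monoid S using S by (simp add: fin_monoid_def)
  define e where "e = (\<lambda>c. fst (prod_decode c))"
  define f where "f = (\<lambda>c. snd (prod_decode c))"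
  define R :: "nat monoid" where "R = \<lparr>carrier = prod_encode ` (carrier T \<times> carrier S),
    mult = (\<lambda>c d. prod_encode (e c \<otimes>\<^bsub>T\<^esub> e d, f c \<otimes>\<^bsub>S\<^esub> f d)), one = prod_encode (\<one>\<^bsub>T\<^esub>, \<one>\<^bsub>S\<^esub>)\<rparr>"
  have [simp]: "e (prod_encode z) = fst z" "f (prod_encode z) = snd z" for z
    by (auto simp: e_def f_def)
  have R: "fin_monoid R"
    unfolding fin_monoid_def
  proof
    show "monoid R"
      by (rule monoidI) (auto simp: R_def T.m_assoc S.m_assoc)
    show "finite (carrier R)" using T S by (simp add: R_def fin_monoid_def)
  qed
  define \<rho> where "\<rho> = (\<lambda>a\<in>A. prod_encode (\<phi> a, \<psi> a))"
  have r: "(R, \<rho>) \<in> tests A"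
    using R T S by (auto simp: tests_iff \<rho>_def R_def)
  have "restrict (e \<circ> \<rho>) A = \<phi>" "restrict (f \<circ> \<rho>) A = \<psi>"
    using T S by (auto simp: \<rho>_def fun_eq_iff PiE_iff extensional_def)
  moreover have "e \<in> mon_hom R T" "f \<in> mon_hom R S"
    by (auto simp: mon_hom_def R_def)
  ultimately show thesis
    using that[OF r] dominates_mon_hom[OF r T(1)] dominates_mon_hom[OF r S(1)] by (simp add: p' q')
qed

lemma tests_nonempty: "\<exists>p. p \<in> tests A"
proof -
  define T :: "nat monoid" where "T = \<lparr>carrier = {0}, mult = (\<lambda>_ _. 0), one = 0\<rparr>"
  have "fin_monoid T" unfolding fin_monoid_def by (auto simp: T_def intro!: monoidI)
  then have "(T, \<lambda>a\<in>A. 0) \<in> tests A" by (auto simp: tests_iff T_def)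
  then show ?thesis by blast
qed

lemma dominates_finite:
  assumes "finite F" "F \<subseteq> tests A"
  obtains q where "q \<in> tests A" "\<And>p. p \<in> F \<Longrightarrow> dominates A q p"
  using assms
proof (induction F arbitrary: thesis rule: finite_induct)
  case empty
  then show ?case using tests_nonempty by blast
next
  case (insert p F)
  then obtain q where q: "q \<in> tests A" "\<And>p. p \<in> F \<Longrightarrow> dominates A q p" by auto
  obtain r where "r \<in> tests A" "dominates A r p" "dominates A r q"
    using dominates_pair[of p A q] q insert.prems by auto
  then show ?case using insert.prems(1)[of r] q dominates_trans by blast
qed

section \<open>Words inside the free profinite monoid\<close>

definition wd :: "nat set \<Rightarrow> nat list \<Rightarrow> pw" where
  "wd A w = foldr (\<lambda>a. omult A (gen A a)) w (oone A)"

lemma wd_Nil [simp]: "wd A [] = oone A"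
  and wd_Cons [simp]: "wd A (a # w) = omult A (gen A a) (wd A w)"
  by (simp_all add: wd_def)

lemma wd_closed [simp]: "set w \<subseteq> A \<Longrightarrow> wd A w \<in> Omega A"
  by (induction w) auto

lemma wd_append [simp]:
  "set v \<subseteq> A \<Longrightarrow> set w \<subseteq> A \<Longrightarrow> wd A (v @ w) = omult A (wd A v) (wd A w)"
  by (induction v) (auto simp: omult_assoc)

text \<open>The value of \<open>u\<close> at a test already lies in the submonoid generated by the letters.\<close>

lemma words_dense:
  assumes u: "u \<in> Omega A" and p: "p \<in> tests A"
  obtains w where "set w \<subseteq> A" "wd A w p = u p"
proof -
  obtain T \<phi> where p': "p = (T, \<phi>)" by (cases p)
  have T: "fin_monoid T" "\<phi> \<in> A \<rightarrow>\<^sub>E carrier T" using p by (auto simp: p' tests_iff)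
  interpret T: monoid T using T by (simp add: fin_monoid_def)
  define R where "R = T\<lparr>carrier := (\<lambda>w. wd A w p) ` {w. set w \<subseteq> A}\<rparr>"
  have sub: "carrier R \<subseteq> carrier T"
    using Omega_carrier[OF wd_closed p] by (auto simp: R_def p')
  have [simp]: "mult R = mult T" "one R = one T" by (simp_all add: R_def)
  have mult: "x \<otimes>\<^bsub>T\<^esub> y \<in> carrier R" if xy: "x \<in> carrier R" "y \<in> carrier R" for x y
  proof -
    obtain v w where "set v \<subseteq> A" "set w \<subseteq> A" "x = wd A v p" "y = wd A w p"
      using xy by (auto simp: R_def)
    then have "set (v @ w) \<subseteq> A" "x \<otimes>\<^bsub>T\<^esub> y = wd A (v @ w) p" using p by (auto simp: p')
    then have "x \<otimes>\<^bsub>T\<^esub> y \<in> (\<lambda>w. wd A w p) ` {w. set w \<subseteq> A}" by blast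
    then show ?thesis by (simp add: R_def)
  qed
  have "\<one>\<^bsub>T\<^esub> = wd A [] p" using p by (simp add: p')
  then have one: "\<one>\<^bsub>T\<^esub> \<in> carrier R"
    unfolding R_def by (auto intro!: image_eqI[where x="[]"])
  have R: "fin_monoid R"
    unfolding fin_monoid_def
  proof
    show "monoid R"
      using sub by (intro monoidI) (auto simp: mult one T.m_assoc subset_iff)
    show "finite (carrier R)" using T sub finite_subset by (auto simp: fin_monoid_def)
  qed
  have "\<phi> a \<in> carrier R" if "a \<in> A" for a
  proof -
    have "\<phi> a = wd A [a] p" using p that T by (auto simp: p')
    then show ?thesis using that by (auto simp: R_def intro!: image_eqI[where x="[a]"])
  qed
  then have r: "(R, \<phi>) \<in> tests A" using R T by (auto simp: tests_iff)
  \<comment> \<open>Naturality along the inclusion of the generated submonoid \<open>R\<close> shows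
    that \<open>u\<close> takes the same value in \<open>R\<close> as in \<open>T\<close>.\<close>
  have "id \<in> mon_hom R T" using sub by (auto simp: mon_hom_def)
  from Omega_natural[OF u r T(1) this] have "u (R, \<phi>) = u p"
    using T(2) by (simp add: p' PiE_restrict)
  moreover have "u (R, \<phi>) \<in> carrier R" using Omega_carrier[OF u r] by simp
  ultimately show thesis using that by (auto simp: R_def)
qed

text \<open>One word approximates \<open>u\<close> at two tests at once. Usually one of them is
  arbitrary and the other fixes the content or a class in some \<open>Q A n\<close>.\<close>

lemma words_dense2:
  assumes u: "u \<in> Omega A" and p: "p \<in> tests A" "q \<in> tests A"
  obtains w where "set w \<subseteq> A" "wd A w p = u p" "wd A w q = u q"
proof -
  obtain r where r: "r \<in> tests A" "dominates A r p" "dominates A r q" using dominates_pair[OF p] .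
  obtain w where "set w \<subseteq> A" "wd A w r = u r" using words_dense[OF u r(1)] .
  then show thesis using that[of w] dominatesD[OF r(2)] dominatesD[OF r(3)] u wd_closed by metis
qed

section \<open>A filtration of the word congruence of DA\<close>

text \<open>Last occurrences enter as first occurrences in the reversed words, which makes the relation
  invariant under reversal by construction.\<close>

primrec eqv :: "nat \<Rightarrow> 'a list \<Rightarrow> 'a list \<Rightarrow> bool" where
  "eqv 0 u v \<longleftrightarrow> set u = set v"
| "eqv (Suc n) u v \<longleftrightarrow> set u = set v \<and>
     (\<forall>a x y x' y'. u = x @ a # y \<longrightarrow> v = x' @ a # y' \<longrightarrow> a \<notin> set x \<longrightarrow> a \<notin> set x' \<longrightarrow>
        eqv n x x' \<and> eqv n y y') \<and>
     (\<forall>a x y x' y'. rev u = x @ a # y \<longrightarrow> rev v = x' @ a # y' \<longrightarrow> a \<notin> set x \<longrightarrow> a \<notin> set x' \<longrightarrow>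
        eqv n x x' \<and> eqv n y y')"

declare eqv.simps(2) [simp del]

lemma first_occurrence_unique:
  "\<lbrakk>x @ a # y = x' @ a # y'; a \<notin> set x; a \<notin> set x'\<rbrakk> \<Longrightarrow> x = x' \<and> y = y'"
  by (induction x arbitrary: x') (auto simp: Cons_eq_append_conv)

lemma last_occurrence_unique:
  assumes "x @ a # y = x' @ a # y'" "a \<notin> set y" "a \<notin> set y'"
  shows "x = x' \<and> y = y'"
proof -
  have "rev y @ a # rev x = rev y' @ a # rev x'" using arg_cong[OF assms(1), of rev] by simp
  from first_occurrence_unique[OF this] assms(2,3) show ?thesis by simp
qed

lemma eqv_set: "eqv n u v \<Longrightarrow> set u = set v"
  by (cases n) (auto simp: eqv.simps(2))

lemma eqv_refl [simp]: "eqv n u u"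
  by (induction n arbitrary: u) (auto simp: eqv.simps(2) dest: first_occurrence_unique)

lemma eqv_sym: "eqv n u v \<Longrightarrow> eqv n v u"
  by (induction n arbitrary: u v) (fastforce simp: eqv.simps(2))+

lemma eqv_trans:
  "\<lbrakk>eqv n u v; eqv n v w\<rbrakk> \<Longrightarrow> eqv n u w"
proof (induction n arbitrary: u v w)
  case 0
  then show ?case by simp
next
  case (Suc n)
  have sets: "set u = set v" "set v = set w" using Suc.prems eqv_set by auto
  \<comment> \<open>Stated for arbitrary words so that it serves both the given words and their
    reversals. Equal contents guarantee that the middle word also splits at
    \<open>a\<close>.\<close>
  have step: "eqv n x x'' \<and> eqv n y y''"
    if "u' = x @ a # y" "w' = x'' @ a # y''" "a \<notin> set x" "a \<notin> set x''" "set u' = set v'"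
      and uv: "\<And>a x y x' y'. \<lbrakk>u' = x @ a # y; v' = x' @ a # y'; a \<notin> set x; a \<notin> set x'\<rbrakk>
                \<Longrightarrow> eqv n x x' \<and> eqv n y y'"
      and vw: "\<And>a x y x' y'. \<lbrakk>v' = x @ a # y; w' = x' @ a # y'; a \<notin> set x; a \<notin> set x'\<rbrakk>
                \<Longrightarrow> eqv n x x' \<and> eqv n y y'"
    for a x y x'' y'' and u' v' w' :: "'a list"
  proof -
    have "a \<in> set v'" using that by auto
    then obtain x' y' where "v' = x' @ a # y'" "a \<notin> set x'" using split_list_first by metis
    then show ?thesis using uv[of x a y x' y'] vw[of x' a y' x'' y''] Suc.IH that(1-4) by blast
  qed
  show ?case
    unfolding eqv.simps(2)
  proof (intro conjI allI impI)
    fix a x y x' y'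
    assume h: "u = x @ a # y" "w = x' @ a # y'" "a \<notin> set x" "a \<notin> set x'"
    have "eqv n x x' \<and> eqv n y y'"
      using Suc.prems sets by (intro step[OF h, of v]) (auto simp: eqv.simps(2))
    then show "eqv n x x'" "eqv n y y'" by auto
  next
    fix a x y x' y'
    assume h: "rev u = x @ a # y" "rev w = x' @ a # y'" "a \<notin> set x" "a \<notin> set x'"
    have "eqv n x x' \<and> eqv n y y'"
      using Suc.prems sets unfolding eqv.simps(2)
      by (intro step[OF h, of "rev v"]) (simp; blast)+
    then show "eqv n x x'" "eqv n y y'" by auto
  qed (use sets in auto)
qed

lemma eqv_rev: "eqv n u v \<Longrightarrow> eqv n (rev u) (rev v)"
  by (cases n) (auto simp: eqv.simps(2))

lemma eqv_rev_iff: "eqv n (rev u) (rev v) \<longleftrightarrow> eqv n u v"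
  using eqv_rev[of n u v] eqv_rev[of n "rev u" "rev v"] by auto

text \<open>Turns the clause about reversed words back into a clause about last occurrences.\<close>

lemma eqv_SucI:
  assumes "set u = set v"
    and "\<And>a x y x' y'. \<lbrakk>u = x @ a # y; v = x' @ a # y'; a \<notin> set x; a \<notin> set x'\<rbrakk>
          \<Longrightarrow> eqv n x x' \<and> eqv n y y'"
    and "\<And>a x y x' y'. \<lbrakk>u = x @ a # y; v = x' @ a # y'; a \<notin> set y; a \<notin> set y'\<rbrakk>
          \<Longrightarrow> eqv n x x' \<and> eqv n y y'"
  shows "eqv (Suc n) u v"
  unfolding eqv.simps(2)
proof (intro conjI allI impI)
  fix a x y x' y'
  assume "rev u = x @ a # y" "rev v = x' @ a # y'" "a \<notin> set x" "a \<notin> set x'"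
  then have "u = rev y @ a # rev x" "v = rev y' @ a # rev x'" "a \<notin> set (rev x)" "a \<notin> set (rev x')"
    by (simp_all add: rev_swap)
  from assms(3)[OF this] show "eqv n x x'" "eqv n y y'" by (auto simp: eqv_rev_iff)
qed (use assms in auto)

lemma eqv_SucD_first:
  "\<lbrakk>eqv (Suc n) (x @ a # y) (x' @ a # y'); a \<notin> set x; a \<notin> set x'\<rbrakk> \<Longrightarrow> eqv n x x' \<and> eqv n y y'"
  by (auto simp: eqv.simps(2))

lemma eqv_SucD_last:
  assumes "eqv (Suc n) (x @ a # y) (x' @ a # y')" "a \<notin> set y" "a \<notin> set y'"
  shows "eqv n x x' \<and> eqv n y y'"
proof -
  have "eqv (Suc n) (rev y @ a # rev x) (rev y' @ a # rev x')"
    using eqv_rev[OF assms(1)] by simp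
  from eqv_SucD_first[OF this] assms show ?thesis by (simp add: eqv_rev_iff)
qed

lemma eqv_Suc: "eqv (Suc n) u v \<Longrightarrow> eqv n u v"
proof (induction n arbitrary: u v)
  case 0
  then show ?case by (simp add: eqv.simps(2))
next
  case (Suc n)
  show ?case
  proof (rule eqv_SucI)
    show "set u = set v" using Suc.prems by (rule eqv_set)
  next
    fix a x y x' y'
    assume "u = x @ a # y" "v = x' @ a # y'" "a \<notin> set x" "a \<notin> set x'"
    then have "eqv (Suc n) x x' \<and> eqv (Suc n) y y'" using Suc.prems eqv_SucD_first by metis
    then show "eqv n x x' \<and> eqv n y y'" using Suc.IH by simp
  next
    fix a x y x' y'
    assume "u = x @ a # y" "v = x' @ a # y'" "a \<notin> set y" "a \<notin> set y'"
    then have "eqv (Suc n) x x' \<and> eqv (Suc n) y y'" using Suc.prems eqv_SucD_last by metis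
    then show "eqv n x x' \<and> eqv n y y'" using Suc.IH by simp
  qed
qed

lemma eqv_mono: "\<lbrakk>eqv n u v; m \<le> n\<rbrakk> \<Longrightarrow> eqv m u v"
  by (induction n) (auto simp: le_Suc_eq dest: eqv_Suc)

text \<open>Since \<open>u\<close> and \<open>v\<close> have the same content, the relevant
  occurrence of a letter in \<open>u @ s\<close> and in \<open>v @ s\<close> lies in the same block,
  either the changing one or the common \<open>s\<close>. The split then changes only one factor, to
  which the induction hypothesis applies.\<close>

lemma eqv_append_right: "eqv n u v \<Longrightarrow> eqv n (u @ s) (v @ s)"
  and eqv_append_left: "eqv n u v \<Longrightarrow> eqv n (s @ u) (s @ v)"
proof -
  have "eqv n u v \<Longrightarrow> eqv n (u @ s) (v @ s) \<and> eqv n (s @ u) (s @ v)"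
  proof (induction n arbitrary: u v s)
    case 0
    then show ?case by simp
  next
    case (Suc n)
    have first: "eqv n x x' \<and> eqv n y y'"
      if uv: "eqv (Suc n) u v" and "u @ s = x @ a # y" "v @ s = x' @ a # y'" "a \<notin> set x" "a \<notin> set x'"
      for u v s :: "'a list" and a x y x' y'
    proof (cases "a \<in> set u")
      case True
      then obtain p q where u: "u = p @ a # q" "a \<notin> set p" using split_list_first by metis
      have "a \<in> set v" using True eqv_set[OF uv] by simp
      then obtain p' q' where v: "v = p' @ a # q'" "a \<notin> set p'" using split_list_first by metis
      have "eqv n p p' \<and> eqv n q q'" using eqv_SucD_first[of n p a q p' q'] uv u v by simp
      moreover have "x @ a # y = p @ a # (q @ s)" using that(2) u(1) by simp
      from first_occurrence_unique[OF this that(4) u(2)] have "x = p" "y = q @ s" by auto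
      moreover have "x' @ a # y' = p' @ a # (q' @ s)" using that(3) v(1) by simp
      from first_occurrence_unique[OF this that(5) v(2)] have "x' = p'" "y' = q' @ s" by auto
      ultimately show ?thesis using Suc.IH by simp
    next
      case False
      then have v: "a \<notin> set v" using eqv_set[OF uv] by simp
      have "a \<in> set (u @ s)" unfolding that by simp
      then have "a \<in> set s" using False by simp
      then obtain p q where s: "s = p @ a # q" "a \<notin> set p" using split_list_first by metis
      have "x @ a # y = (u @ p) @ a # q" using that(2) s(1) by simp
      from first_occurrence_unique[OF this that(4)] have "x = u @ p" "y = q" using False s(2) by auto
      moreover have "x' @ a # y' = (v @ p) @ a # q" using that(3) s(1) by simp
      from first_occurrence_unique[OF this that(5)] have "x' = v @ p" "y' = q" using v s(2) by auto
      ultimately show ?thesis using Suc.IH eqv_Suc[OF uv] by simp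
    qed
    have last: "eqv n x x' \<and> eqv n y y'"
      if uv: "eqv (Suc n) u v" and "u @ s = x @ a # y" "v @ s = x' @ a # y'" "a \<notin> set y" "a \<notin> set y'"
      for u v s :: "'a list" and a x y x' y'
    proof (cases "a \<in> set s")
      case True
      then obtain p q where s: "s = p @ a # q" "a \<notin> set q" using split_list_last by metis
      have "x @ a # y = (u @ p) @ a # q" using that(2) s(1) by simp
      from last_occurrence_unique[OF this that(4) s(2)] have "x = u @ p" "y = q" by auto
      moreover have "x' @ a # y' = (v @ p) @ a # q" using that(3) s(1) by simp
      from last_occurrence_unique[OF this that(5) s(2)] have "x' = v @ p" "y' = q" by auto
      ultimately show ?thesis using Suc.IH eqv_Suc[OF uv] by simp
    next
      case False
      have "a \<in> set (u @ s)" unfolding that by simp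
      then have au: "a \<in> set u" using False by simp
      then obtain p q where u: "u = p @ a # q" "a \<notin> set q" using split_list_last by metis
      have "a \<in> set v" using au eqv_set[OF uv] by simp
      then obtain p' q' where v: "v = p' @ a # q'" "a \<notin> set q'" using split_list_last by metis
      have "eqv n p p' \<and> eqv n q q'" using eqv_SucD_last[of n p a q p' q'] uv u v by simp
      moreover have "x @ a # y = p @ a # (q @ s)" using that(2) u(1) by simp
      from last_occurrence_unique[OF this that(4)] have "x = p" "y = q @ s" using False u(2) by auto
      moreover have "x' @ a # y' = p' @ a # (q' @ s)" using that(3) v(1) by simp
      from last_occurrence_unique[OF this that(5)] have "x' = p'" "y' = q' @ s" using False v(2) by auto
      ultimately show ?thesis using Suc.IH by simp
    qed
    have right: "eqv (Suc n) (u @ s) (v @ s)" if uv: "eqv (Suc n) u v" for u v s :: "'a list"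
      using first[OF uv] last[OF uv] eqv_set[OF uv] by (intro eqv_SucI) auto
    \<comment> \<open>Left multiplication is right multiplication of the reversed words.\<close>
    have "eqv (Suc n) (rev (s @ u)) (rev (s @ v))"
      using right[OF eqv_rev[OF Suc.prems], of "rev s"] by simp
    then show ?case using right[OF Suc.prems] by (simp only: eqv_rev_iff)
  qed
  then show "eqv n u v \<Longrightarrow> eqv n (u @ s) (v @ s)" "eqv n u v \<Longrightarrow> eqv n (s @ u) (s @ v)" by auto
qed

lemma eqv_append: "\<lbrakk>eqv n u u'; eqv n v v'\<rbrakk> \<Longrightarrow> eqv n (u @ v) (u' @ v')"
  using eqv_append_left eqv_append_right eqv_trans by metis

section \<open>Pumping: powers hide factors over the same letters\<close>

abbreviation lpow :: "'a list \<Rightarrow> nat \<Rightarrow> 'a list" where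
  "lpow u k \<equiv> concat (replicate k u)"

lemma lpow_add: "lpow u (k + l) = lpow u k @ lpow u l"
  by (simp add: replicate_add)

lemma lpow_Suc_right: "lpow u (Suc k) = lpow u k @ u"
  using lpow_add[of k 1 u] by simp

lemma lpow_rev: "rev (lpow u k) = lpow (rev u) k"
proof (induction k)
  case (Suc k)
  then show ?case unfolding lpow_Suc_right[of k "rev u"] by simp
qed simp

lemma set_lpow: "set (lpow u k) \<subseteq> set u"
  by (induction k) auto

text \<open>A first-occurrence split is decided inside the leading copy of \<open>u\<close>, a
  last-occurrence split inside the trailing copy. Each level uses up one copy on either side, so
  \<open>Suc n\<close> copies protect the middle at level \<open>n\<close>.\<close>

lemma eqv_pump:
  assumes "set s \<subseteq> set u" "set t \<subseteq> set u"
  shows "eqv n (lpow u (Suc n) @ s @ lpow u (Suc n)) (lpow u (Suc n) @ t @ lpow u (Suc n))"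
  using assms
proof (induction n arbitrary: u s t)
  case 0
  then show ?case by auto
next
  case (Suc n)
  have first: "eqv n x x' \<and> eqv n y y'"
    if st: "set s \<subseteq> set u" "set t \<subseteq> set u"
      and h: "lpow u (Suc (Suc n)) @ s @ lpow u (Suc (Suc n)) = x @ a # y"
        "lpow u (Suc (Suc n)) @ t @ lpow u (Suc (Suc n)) = x' @ a # y'" "a \<notin> set x" "a \<notin> set x'"
    for u s t :: "'a list" and a x y x' y'
  proof -
    have "a \<in> set (lpow u (Suc (Suc n)) @ s @ lpow u (Suc (Suc n)))" unfolding h by simp
    then have "a \<in> set u" using st set_lpow[of "Suc (Suc n)" u] by auto
    then obtain p q where u: "u = p @ a # q" "a \<notin> set p" using split_list_first by metis
    \<comment> \<open>The leading copy is cut at \<open>a\<close>. The trailing copy is set aside as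
      a common right factor, which leaves an instance of level \<open>n\<close>.\<close>
    have *: "lpow u (Suc (Suc n)) @ w @ lpow u (Suc (Suc n)) =
        p @ a # (q @ (lpow u (Suc n) @ w @ lpow u (Suc n)) @ u)" for w
    proof -
      have "lpow u (Suc (Suc n)) @ w @ lpow u (Suc (Suc n)) = (u @ lpow u (Suc n)) @ w @ (lpow u (Suc n) @ u)"
        unfolding lpow_Suc_right[of "Suc n" u, symmetric] by (simp only: replicate_Suc concat.simps)
      also have "\<dots> = p @ a # (q @ (lpow u (Suc n) @ w @ lpow u (Suc n)) @ u)"
        by (subst (1) u(1)) (simp only: append_assoc append_Cons)
      finally show ?thesis .
    qed
    have "x = p \<and> y = q @ (lpow u (Suc n) @ s @ lpow u (Suc n)) @ u"
      "x' = p \<and> y' = q @ (lpow u (Suc n) @ t @ lpow u (Suc n)) @ u"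
      using h(1,2)[unfolded *] h(3,4) u(2) first_occurrence_unique by metis+
    then show ?thesis using eqv_append_left[OF eqv_append_right[OF Suc.IH[OF st]]] by simp
  qed
  show ?case
    unfolding eqv.simps(2)
  proof (intro conjI allI impI)
    show "set (lpow u (Suc (Suc n)) @ s @ lpow u (Suc (Suc n))) = set (lpow u (Suc (Suc n)) @ t @ lpow u (Suc (Suc n)))"
      using Suc.prems by auto
  next
    fix a x y x' y'
    assume h: "lpow u (Suc (Suc n)) @ s @ lpow u (Suc (Suc n)) = x @ a # y"
        "lpow u (Suc (Suc n)) @ t @ lpow u (Suc (Suc n)) = x' @ a # y'" "a \<notin> set x" "a \<notin> set x'"
    from first[OF Suc.prems h] show "eqv n x x'" "eqv n y y'" by auto
  next
    fix a x y x' y'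
    assume "rev (lpow u (Suc (Suc n)) @ s @ lpow u (Suc (Suc n))) = x @ a # y"
        "rev (lpow u (Suc (Suc n)) @ t @ lpow u (Suc (Suc n))) = x' @ a # y'" "a \<notin> set x" "a \<notin> set x'"
    then have "eqv n x x' \<and> eqv n y y'"
      using Suc.prems
      by (intro first[of "rev s" "rev u" "rev t" x a y x' y']) (simp_all only: rev_append lpow_rev append_assoc set_rev not_False_eq_True)
    then show "eqv n x x'" "eqv n y y'" by auto
  qed
qed

text \<open>Copies beyond \<open>Suc n\<close> are moved into the middle, so the four exponents may
  differ. This suits omega powers, which are known only as powers with large factorial
  exponents.\<close>

lemma eqv_pump_pow:
  assumes "k > n" "l > n" "k' > n" "l' > n" "set s \<subseteq> set u" "set t \<subseteq> set u"
  shows "eqv n (lpow u k @ s @ lpow u l) (lpow u k' @ t @ lpow u l')"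
proof -
  have dec: "lpow u i @ w @ lpow u j =
      lpow u (Suc n) @ (lpow u (i - Suc n) @ w @ lpow u (j - Suc n)) @ lpow u (Suc n)"
    if "i > n" "j > n" for i j w
    using lpow_add[of "Suc n" "i - Suc n" u] lpow_add[of "j - Suc n" "Suc n" u] that by (simp del: replicate.simps(2))
  show ?thesis
    unfolding dec[OF assms(1,2)] dec[OF assms(3,4)]
    unfolding set_append by (intro eqv_pump; unfold set_append; intro Un_least set_lpow assms)
qed

section \<open>The finite quotients of the free monoid\<close>

text \<open>A class of level \<open>Suc n\<close> is determined by the content and by the finite
  sets of triples (letter, class of the left factor, class of the right factor), all classes being
  of level \<open>n\<close>.\<close>

lemma eqv_finite_index:
  assumes A: "finite A"
  shows "finite ((\<lambda>w. {w'. set w' \<subseteq> A \<and> eqv n w w'}) ` {w. set w \<subseteq> A})"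
    (is "finite (?c n ` ?W)")
proof (induction n)
  case 0
  have "?c 0 ` ?W \<subseteq> (\<lambda>B. {w'. set w' \<subseteq> A \<and> B = set w'}) ` Pow A"
    unfolding eqv.simps by (intro image_subsetI) blast
  then show ?case by (rule finite_subset) (simp add: A)
next
  case (Suc n)
  define K where "K = ?c n"
  have K: "finite (K ` ?W)" using Suc by (simp add: K_def)
  have cls: "eqv n x x'" if "K x = K x'" "set x' \<subseteq> A" for x x'
    using that eqv_refl[of n x'] unfolding K_def by blast
  define f where "f = (\<lambda>w. (set w,
     {(a, K x, K y) | a x y. w = x @ a # y \<and> a \<notin> set x},
     {(a, K x, K y) | a x y. w = x @ a # y \<and> a \<notin> set y}))"
  have eq: "eqv (Suc n) w w'" if f: "f w = f w'" and W: "set w \<subseteq> A" "set w' \<subseteq> A" for w w'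
  proof (rule eqv_SucI)
    show "set w = set w'" using arg_cong[OF f, of fst] by (simp add: f_def)
  next
    fix a x y x' y'
    assume h: "w = x @ a # y" "w' = x' @ a # y'" "a \<notin> set x" "a \<notin> set x'"
    have "(a, K x, K y) \<in> fst (snd (f w))" unfolding f_def fst_conv snd_conv using h by blast
    then obtain x'' y'' where *: "w' = x'' @ a # y''" "a \<notin> set x''" "K x = K x''" "K y = K y''"
      unfolding f unfolding f_def fst_conv snd_conv by blast
    have "x'' @ a # y'' = x' @ a # y'" using *(1) h(2) by simp
    from first_occurrence_unique[OF this *(2) h(4)] have "K x = K x'" "K y = K y'" using *(3,4) by auto
    moreover have "set x' \<subseteq> A" "set y' \<subseteq> A" using W(2) unfolding h(2) by auto
    ultimately show "eqv n x x' \<and> eqv n y y'" using cls by blast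
  next
    fix a x y x' y'
    assume h: "w = x @ a # y" "w' = x' @ a # y'" "a \<notin> set y" "a \<notin> set y'"
    have "(a, K x, K y) \<in> snd (snd (f w))" unfolding f_def fst_conv snd_conv using h by blast
    then obtain x'' y'' where *: "w' = x'' @ a # y''" "a \<notin> set y''" "K x = K x''" "K y = K y''"
      unfolding f unfolding f_def fst_conv snd_conv by blast
    have "x'' @ a # y'' = x' @ a # y'" using *(1) h(2) by simp
    from last_occurrence_unique[OF this *(2) h(4)] have "K x = K x'" "K y = K y'" using *(3,4) by auto
    moreover have "set x' \<subseteq> A" "set y' \<subseteq> A" using W(2) unfolding h(2) by auto
    ultimately show "eqv n x x' \<and> eqv n y y'" using cls by blast
  qed
  have "f ` ?W \<subseteq> Pow A \<times> Pow (A \<times> K ` ?W \<times> K ` ?W) \<times> Pow (A \<times> K ` ?W \<times> K ` ?W)"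
    by (auto simp: f_def)
  then have fin: "finite (f ` ?W)" by (rule finite_subset) (simp add: A K)
  \<comment> \<open>The class is rewritten as a function of \<open>f w\<close> alone, so the set of
    classes is an image of the finite set of values of \<open>f\<close>.\<close>
  have "?c (Suc n) w = {w'. set w' \<subseteq> A \<and> (\<exists>v. set v \<subseteq> A \<and> f v = f w \<and> eqv (Suc n) v w')}" if "w \<in> ?W" for w
  proof (intro Collect_cong conj_cong refl iffI)
    fix w' assume "eqv (Suc n) w w'"
    then show "\<exists>v. set v \<subseteq> A \<and> f v = f w \<and> eqv (Suc n) v w'" using that by auto
  next
    fix w' assume "\<exists>v. set v \<subseteq> A \<and> f v = f w \<and> eqv (Suc n) v w'"
    then obtain v where v: "set v \<subseteq> A" "f v = f w" "eqv (Suc n) v w'" by blast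
    then have "eqv (Suc n) w v" using eq[of w v] that by simp
    then show "eqv (Suc n) w w'" using v(3) by (rule eqv_trans)
  qed
  then have "?c (Suc n) ` ?W \<subseteq> (\<lambda>z. {w'. set w' \<subseteq> A \<and> (\<exists>v. set v \<subseteq> A \<and> f v = z \<and> eqv (Suc n) v w')}) ` f ` ?W"
    unfolding image_image by (intro image_subsetI) simp
  then show ?case by (rule finite_subset) (rule finite_imageI[OF fin])
qed

text \<open>A canonical representative: equivalent words define the same predicate, so the choice
  operator returns the same word for both.\<close>

definition rep :: "nat set \<Rightarrow> nat \<Rightarrow> nat list \<Rightarrow> nat list" where
  "rep A n w = (SOME w'. set w' \<subseteq> A \<and> eqv n w w')"

definition code :: "nat set \<Rightarrow> nat \<Rightarrow> nat list \<Rightarrow> nat" where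
  "code A n w = list_encode (rep A n w)"

lemma rep: "set w \<subseteq> A \<Longrightarrow> set (rep A n w) \<subseteq> A \<and> eqv n w (rep A n w)"
  unfolding rep_def by (rule someI[of _ w]) simp

lemma rep_eq_iff:
  assumes "set v \<subseteq> A" "set w \<subseteq> A"
  shows "rep A n v = rep A n w \<longleftrightarrow> eqv n v w"
proof
  assume "rep A n v = rep A n w"
  then show "eqv n v w" using rep[OF assms(1), of n] rep[OF assms(2), of n] eqv_trans eqv_sym by metis
next
  assume "eqv n v w"
  then have "eqv n v = eqv n w" using eqv_trans eqv_sym by (intro ext) blast
  then show "rep A n v = rep A n w" by (simp add: rep_def)
qed

lemma code_eq_iff:
  "\<lbrakk>set v \<subseteq> A; set w \<subseteq> A\<rbrakk> \<Longrightarrow> code A n v = code A n w \<longleftrightarrow> eqv n v w"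
  by (simp add: code_def rep_eq_iff list_encode_eq)

text \<open>The quotient of the words over \<open>A\<close> by \<open>eqv n\<close>, each class
  being named by the number of its representative.\<close>

definition Q :: "nat set \<Rightarrow> nat \<Rightarrow> nat monoid" where
  "Q A n = \<lparr>carrier = code A n ` {w. set w \<subseteq> A},
     mult = (\<lambda>c d. code A n (list_decode c @ list_decode d)), one = code A n []\<rparr>"

text \<open>Evaluation at this test is the canonical projection of the free profinite monoid onto
  \<open>Q A n\<close>.\<close>

definition Qtest :: "nat set \<Rightarrow> nat \<Rightarrow> test" where
  "Qtest A n = (Q A n, \<lambda>a\<in>A. code A n [a])"

lemma Q_mult:
  assumes "set v \<subseteq> A" "set w \<subseteq> A"
  shows "code A n v \<otimes>\<^bsub>Q A n\<^esub> code A n w = code A n (v @ w)"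
proof -
  have "eqv n (v @ w) (rep A n v @ rep A n w)" using rep[OF assms(1)] rep[OF assms(2)] eqv_append by blast
  then show ?thesis
    using rep[OF assms(1), of n] rep[OF assms(2), of n] assms
    by (simp add: Q_def code_def[of A n v] code_def[of A n w] code_eq_iff eqv_sym)
qed

lemma Q_carrierE:
  assumes "c \<in> carrier (Q A n)"
  obtains w where "set w \<subseteq> A" "c = code A n w"
  using assms by (auto simp: Q_def)

lemma Q_carrierI [simp]: "set w \<subseteq> A \<Longrightarrow> code A n w \<in> carrier (Q A n)"
  by (simp add: Q_def)

lemma Q_one: "\<one>\<^bsub>Q A n\<^esub> = code A n []"
  by (simp add: Q_def)

lemma Q_fin_monoid:
  assumes "finite A"
  shows "fin_monoid (Q A n)"
  unfolding fin_monoid_def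
proof
  show "monoid (Q A n)"
    by (rule monoidI) (auto simp: Q_mult Q_one elim!: Q_carrierE)
  have "code A n w = list_encode (SOME w'. w' \<in> {w'. set w' \<subseteq> A \<and> eqv n w w'})" for w
    by (simp add: code_def rep_def)
  then have "carrier (Q A n) = (\<lambda>X. list_encode (SOME w'. w' \<in> X)) ` (\<lambda>w. {w'. set w' \<subseteq> A \<and> eqv n w w'}) ` {w. set w \<subseteq> A}"
    by (simp add: Q_def image_image)
  then show "finite (carrier (Q A n))" using eqv_finite_index[OF assms] by simp
qed

lemma Qtest_tests [simp]: "finite A \<Longrightarrow> Qtest A n \<in> tests A"
  by (auto simp: Qtest_def tests_iff Q_fin_monoid)

lemma fst_Qtest [simp]: "fst (Qtest A n) = Q A n"
  and snd_Qtest [simp]: "a \<in> A \<Longrightarrow> snd (Qtest A n) a = code A n [a]"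
  by (simp_all add: Qtest_def)

lemma wd_Qtest:
  assumes "finite A" "set w \<subseteq> A"
  shows "wd A w (Qtest A n) = code A n w"
  using assms(2)
proof (induction w)
  case Nil
  then show ?case using assms by (simp add: Q_one)
next
  case (Cons a w)
  then show ?case using assms(1) Q_mult[of "[a]" A w n] by simp
qed

section \<open>Topology of the free profinite monoid\<close>

lemma topspace_OmegaTop [simp]: "topspace (OmegaTop A) = Omega A"
  by (auto simp: OmegaTop_def Omega_def)

text \<open>A basic open set restricts finitely many coordinates, and one test dominating all of
  them suffices.\<close>

lemma OmegaTop_nbhd:
  assumes U: "openin (OmegaTop A) U" and u: "u \<in> U"
  obtains p where "p \<in> tests A" "\<And>w. w \<in> Omega A \<Longrightarrow> w p = u p \<Longrightarrow> w \<in> U"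
proof -
  have uO: "u \<in> Omega A" using openin_subset[OF U] u by auto
  obtain V where V: "openin (product_topology (\<lambda>_. discrete_topology UNIV) (tests A)) V" "U = V \<inter> Omega A"
    using U unfolding OmegaTop_def openin_subtopology by blast
  then obtain W where W: "finite {p \<in> tests A. W p \<noteq> UNIV}" "u \<in> PiE (tests A) W" "PiE (tests A) W \<subseteq> V"
    using u unfolding openin_product_topology_alt by (auto simp: Ball_def)
  obtain p where p: "p \<in> tests A" "\<And>q. q \<in> {p \<in> tests A. W p \<noteq> UNIV} \<Longrightarrow> dominates A p q"
    using dominates_finite[OF W(1), of A] by blast
  show thesis
  proof (rule that[OF p(1)])
    fix w assume w: "w \<in> Omega A" "w p = u p"
    have "w q \<in> W q" if q: "q \<in> tests A" for q
    proof (cases "W q = UNIV")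
      case False
      then have "w q = u q" using dominatesD[OF p(2) w(2) w(1) uO] q by simp
      then show ?thesis using W(2) q by (simp add: PiE_mem)
    qed simp
    then have "w \<in> PiE (tests A) W" using Omega_extensional[OF w(1)] by (simp add: PiE_iff)
    then show "w \<in> U" using V(2) W(3) w(1) by blast
  qed
qed

lemma openin_OmegaTop_eval:
  assumes "p \<in> tests A"
  shows "openin (OmegaTop A) {w \<in> Omega A. w p \<in> C}"
proof -
  have "continuous_map (product_topology (\<lambda>_. discrete_topology (UNIV::nat set)) (tests A)) (discrete_topology UNIV) (\<lambda>w. w p)"
    using assms by (rule continuous_map_product_projection)
  then have "continuous_map (OmegaTop A) (discrete_topology UNIV) (\<lambda>w. w p)"
    unfolding OmegaTop_def by (rule continuous_map_from_subtopology)
  then show ?thesis unfolding continuous_map by (simp add: continuous_map_def)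
qed

lemma continuous_map_OmegaTop_discrete:
  assumes "h \<in> Omega A \<rightarrow> D"
    and "\<And>u. u \<in> Omega A \<Longrightarrow> \<exists>p\<in>tests A. \<forall>w\<in>Omega A. w p = u p \<longrightarrow> h w = h u"
  shows "continuous_map (OmegaTop A) (discrete_topology D) h"
  unfolding continuous_map_def
proof (intro conjI allI impI)
  fix U
  show "openin (OmegaTop A) {x \<in> topspace (OmegaTop A). h x \<in> U}"
  proof (subst openin_subopen, intro ballI)
    fix u assume u: "u \<in> {x \<in> topspace (OmegaTop A). h x \<in> U}"
    then obtain p where "p \<in> tests A" "\<forall>w\<in>Omega A. w p = u p \<longrightarrow> h w = h u" using assms(2)[of u] by auto
    then show "\<exists>T. openin (OmegaTop A) T \<and> u \<in> T \<and> T \<subseteq> {x \<in> topspace (OmegaTop A). h x \<in> U}"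
      using u openin_OmegaTop_eval[of p A "{u p}"]
      by (intro exI[of _ "{w \<in> Omega A. w p \<in> {u p}}"]) auto
  qed
qed (use assms in auto)

lemma continuous_map_OmegaTop:
  assumes "f \<in> Omega B \<rightarrow> Omega A"
    and "\<And>p. p \<in> tests A \<Longrightarrow> \<exists>q\<in>tests B. \<forall>u\<in>Omega B. \<forall>w\<in>Omega B. w q = u q \<longrightarrow> f w p = f u p"
  shows "continuous_map (OmegaTop B) (OmegaTop A) f"
  unfolding continuous_map_def
proof (intro conjI allI impI)
  fix U assume U: "openin (OmegaTop A) U"
  show "openin (OmegaTop B) {x \<in> topspace (OmegaTop B). f x \<in> U}"
  proof (subst openin_subopen, intro ballI)
    fix u assume u: "u \<in> {x \<in> topspace (OmegaTop B). f x \<in> U}"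
    then obtain p where p: "p \<in> tests A" "\<And>w. w \<in> Omega A \<Longrightarrow> w p = f u p \<Longrightarrow> w \<in> U"
      using OmegaTop_nbhd[OF U, of "f u"] by auto
    then obtain q where q: "q \<in> tests B" "\<forall>u\<in>Omega B. \<forall>w\<in>Omega B. w q = u q \<longrightarrow> f w p = f u p"
      using assms(2) by blast
    then have "{w \<in> Omega B. w q \<in> {u q}} \<subseteq> {x \<in> topspace (OmegaTop B). f x \<in> U}"
      using p(2) u assms(1) by auto
    then show "\<exists>T. openin (OmegaTop B) T \<and> u \<in> T \<and> T \<subseteq> {x \<in> topspace (OmegaTop B). f x \<in> U}"
      using u openin_OmegaTop_eval[OF q(1), of "{u q}"] by auto
  qed
qed (use assms in auto)

lemma Hausdorff_OmegaTop: "Hausdorff_space (OmegaTop A)"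
  unfolding OmegaTop_def
  by (intro Hausdorff_space_subtopology) (simp add: Hausdorff_space_product_topology Hausdorff_space_discrete_topology)

text \<open>A function outside \<open>Omega A\<close> already fails at one coordinate (value outside
  the carrier) or at two (naturality), and this failure persists on a box.\<close>

lemma closedin_Omega:
  "closedin (product_topology (\<lambda>_. discrete_topology UNIV) (tests A)) (Omega A)"
    (is "closedin ?X _")
  unfolding closedin_def
proof
  show "Omega A \<subseteq> topspace ?X" by (auto simp: Omega_def)
  have box: "openin ?X {v \<in> topspace ?X. v p = w p}" if "p \<in> tests A" for p and w :: pw
  proof -
    have "continuous_map ?X (discrete_topology UNIV) (\<lambda>v. v p)"
      using that by (rule continuous_map_product_projection)
    from openin_continuous_map_preimage[OF this, of "{w p}"] show ?thesis by simp
  qed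
  show "openin ?X (topspace ?X - Omega A)"
  proof (subst openin_subopen, intro ballI)
    fix w assume w: "w \<in> topspace ?X - Omega A"
    then obtain T \<phi> where t: "(T, \<phi>) \<in> tests A" and
      bad: "w (T, \<phi>) \<notin> carrier T \<or> (\<exists>S h. fin_monoid S \<and> h \<in> mon_hom T S \<and> h (w (T, \<phi>)) \<noteq> w (S, restrict (h \<circ> \<phi>) A))"
      using OmegaI[of w A] by (auto simp: PiE_iff)
    from bad show "\<exists>T. openin ?X T \<and> w \<in> T \<and> T \<subseteq> topspace ?X - Omega A"
    proof
      assume "w (T, \<phi>) \<notin> carrier T"
      then have "{v \<in> topspace ?X. v (T, \<phi>) = w (T, \<phi>)} \<subseteq> topspace ?X - Omega A"
        using Omega_carrier[OF _ t] by (metis (mono_tags, lifting) DiffI fst_conv mem_Collect_eq subsetI)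
      then show ?thesis using box[OF t, of w] w by blast
    next
      assume "\<exists>S h. fin_monoid S \<and> h \<in> mon_hom T S \<and> h (w (T, \<phi>)) \<noteq> w (S, restrict (h \<circ> \<phi>) A)"
      then obtain S h where S: "fin_monoid S" "h \<in> mon_hom T S" "h (w (T, \<phi>)) \<noteq> w (S, restrict (h \<circ> \<phi>) A)" by blast
      let ?N = "{v \<in> topspace ?X. v (T, \<phi>) = w (T, \<phi>)} \<inter>
        {v \<in> topspace ?X. v (S, restrict (h \<circ> \<phi>) A) = w (S, restrict (h \<circ> \<phi>) A)}"
      have "openin ?X ?N" by (intro openin_Int box t mon_hom_tests[OF t S(1,2)])
      moreover have "?N \<subseteq> topspace ?X - Omega A"
      proof
        fix v assume v: "v \<in> ?N"
        then have "h (v (T, \<phi>)) \<noteq> v (S, restrict (h \<circ> \<phi>) A)" using S(3) by simp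
        then show "v \<in> topspace ?X - Omega A" using Omega_natural[OF _ t S(1,2), of v] v by blast
      qed
      ultimately show ?thesis using w by blast
    qed
  qed
qed

text \<open>Tychonoff's theorem for the finite carriers, together with closedness.\<close>

lemma compact_OmegaTop: "compact_space (OmegaTop A)"
proof -
  let ?X = "product_topology (\<lambda>_. discrete_topology (UNIV::nat set)) (tests A)"
  have "compactin ?X (PiE (tests A) (\<lambda>p. carrier (fst p)))"
    by (auto simp: compactin_PiE compactin_discrete_topology tests_finite)
  moreover have "Omega A \<subseteq> PiE (tests A) (\<lambda>p. carrier (fst p))"
    using Omega_carrier Omega_extensional by (intro subsetI PiE_I) (auto simp: extensional_def)
  ultimately have "compactin ?X (Omega A)"
    using closedin_Omega closed_compactin by blast
  then show ?thesis unfolding OmegaTop_def by (rule compact_space_subtopology)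
qed

text \<open>\<open>t\<close> is a net of \<open>k\<close>-tuples indexed by tests, and
  \<open>s\<close> is a cluster point of it. In applications \<open>t q\<close> solves a system of
  equations at the test \<open>q\<close>. Because \<open>q\<close> dominates \<open>p\<close>, the
  solution is also valid at \<open>p\<close>, so \<open>s\<close> solves the system at every
  test.\<close>

lemma Omega_cluster:
  fixes t :: "test \<Rightarrow> nat \<Rightarrow> pw"
  assumes t: "\<And>q i. q \<in> tests A \<Longrightarrow> i < k \<Longrightarrow> t q i \<in> Omega A"
  obtains s where "\<And>i. i < k \<Longrightarrow> s i \<in> Omega A"
    "\<And>p. p \<in> tests A \<Longrightarrow> \<exists>q\<in>tests A. dominates A q p \<and> (\<forall>i<k. t q i p = s i p)"
proof -
  let ?Y = "product_topology (\<lambda>_::nat. OmegaTop A) {..<k}"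
  define r where "r = (\<lambda>q. restrict (t q) {..<k})"
  \<comment> \<open>The closure of the tail of the net beyond \<open>p\<close>. Directedness gives
    these sets the finite intersection property.\<close>
  define K where "K p = ?Y closure_of (r ` {q \<in> tests A. dominates A q p})" for p
  have r: "r q \<in> topspace ?Y" if "q \<in> tests A" for q
    using t that by (auto simp: r_def)
  have "compact_space ?Y" by (simp add: compact_space_product_topology compact_OmegaTop)
  moreover have "\<forall>C\<in>K ` tests A. closedin ?Y C" by (simp add: K_def)
  moreover have "\<Inter>F \<noteq> {}" if F: "finite F" "F \<subseteq> K ` tests A" for F
  proof -
    obtain P where P: "P \<subseteq> tests A" "finite P" "F = K ` P" using finite_subset_image[OF F] by blast
    obtain q where q: "q \<in> tests A" "\<And>p. p \<in> P \<Longrightarrow> dominates A q p" using dominates_finite[OF P(2,1)] by blast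
    have "r q \<in> K p" if "p \<in> P" for p
    proof -
      have "r q \<in> topspace ?Y \<inter> r ` {q \<in> tests A. dominates A q p}" using r[OF q(1)] q(1) q(2)[OF that] by simp
      then show ?thesis unfolding K_def by (rule subsetD[OF closure_of_subset_Int])
    qed
    then show ?thesis using P by blast
  qed
  ultimately have "\<Inter>(K ` tests A) \<noteq> {}"
    using iffD1[OF compact_space_fip, rule_format, of ?Y "K ` tests A"] by simp
  then obtain s where s: "\<And>p. p \<in> tests A \<Longrightarrow> s \<in> K p" by blast
  obtain p0 where "p0 \<in> tests A" using tests_nonempty by blast
  then have sY: "s \<in> topspace ?Y" using s unfolding K_def by (meson in_closure_of)
  show thesis
  proof (rule that)
    show "s i \<in> Omega A" if "i < k" for i using sY that by auto
  next
    fix p assume p: "p \<in> tests A"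
    let ?N = "PiE {..<k} (\<lambda>i. {w \<in> Omega A. w p \<in> {s i p}})"
    have "openin ?Y ?N"
      unfolding openin_PiE[OF finite_lessThan] using openin_OmegaTop_eval[OF p] by blast
    moreover have "s \<in> ?N" using sY by (auto simp: PiE_iff)
    ultimately obtain y where y: "y \<in> r ` {q \<in> tests A. dominates A q p}" "y \<in> ?N"
      using s[OF p] unfolding K_def in_closure_of by blast
    then obtain q where q: "q \<in> tests A" "dominates A q p" "y = r q" by blast
    have "t q i p = s i p" if "i < k" for i using y(2) that unfolding q(3) r_def by (auto simp: PiE_iff)
    then show "\<exists>q\<in>tests A. dominates A q p \<and> (\<forall>i<k. t q i p = s i p)" using q by blast
  qed
qed

lemma limitin_OmegaTopI:
  assumes "y \<in> Omega A" "\<And>n. f n \<in> Omega A"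
    "\<And>p. p \<in> tests A \<Longrightarrow> \<exists>n0. \<forall>n\<ge>n0. f n p = y p"
  shows "limitin (OmegaTop A) f y sequentially"
  unfolding limitin_def
proof (intro conjI allI impI)
  fix U assume U: "openin (OmegaTop A) U \<and> y \<in> U"
  obtain p where "p \<in> tests A" "\<And>w. w \<in> Omega A \<Longrightarrow> w p = y p \<Longrightarrow> w \<in> U"
    using OmegaTop_nbhd U by metis
  moreover obtain n0 where "\<forall>n\<ge>n0. f n p = y p" using assms(3)[OF \<open>p \<in> tests A\<close>] by blast
  ultimately show "\<forall>\<^sub>F n in sequentially. f n \<in> U"
    using assms(2) unfolding eventually_sequentially by blast
qed (use assms in simp)

section \<open>Omega powers as pointwise eventual values\<close>

lemma opow_fact_stable:
  assumes x: "x \<in> Omega A" and p: "p \<in> tests A"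
  obtains m0 where "\<And>m. m \<ge> m0 \<Longrightarrow> opow A x (fact m) p = opow A x (fact m0) p"
    "opow A x (fact m0) p \<otimes>\<^bsub>fst p\<^esub> opow A x (fact m0) p = opow A x (fact m0) p"
proof -
  interpret monoid "fst p" by (rule tests_monoid[OF p])
  obtain m0 where "\<And>m. m \<ge> m0 \<Longrightarrow> x p [^]\<^bsub>fst p\<^esub> (fact m :: nat) = x p [^]\<^bsub>fst p\<^esub> (fact m0 :: nat)"
    "x p [^]\<^bsub>fst p\<^esub> (fact m0 :: nat) \<otimes>\<^bsub>fst p\<^esub> x p [^]\<^bsub>fst p\<^esub> (fact m0 :: nat) = x p [^]\<^bsub>fst p\<^esub> (fact m0 :: nat)"
    using finite_pow_fact[OF tests_finite[OF p] Omega_carrier[OF x p]] by blast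
  then show thesis using that[of m0] unfolding opow_apply[OF x p] by blast
qed

text \<open>At each test the factorial powers stabilize. The eventual values form an implicit
  operation because any two tests share a stage, and Hausdorffness identifies it with the limit in
  the definition.\<close>

lemma omega_pow_limit:
  assumes x: "x \<in> Omega A"
  shows omega_pow_closed: "omega_pow A x \<in> Omega A"
    and omega_pow_eventually: "p \<in> tests A \<Longrightarrow> \<exists>m0. \<forall>m\<ge>m0. opow A x (fact m) p = omega_pow A x p"
    and omega_pow_limitin: "limitin (OmegaTop A) (\<lambda>n. opow A x (fact n)) (omega_pow A x) sequentially"
proof -
  have "\<exists>m0. \<forall>m\<ge>m0. opow A x (fact m) p = opow A x (fact m0) p" if p: "p \<in> tests A" for p
    using opow_fact_stable[OF x p] by metis
  then obtain M where M: "\<And>p m. p \<in> tests A \<Longrightarrow> m \<ge> M p \<Longrightarrow> opow A x (fact m) p = opow A x (fact (M p)) p"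
    by metis
  define y where "y = (\<lambda>p\<in>tests A. opow A x (fact (M p)) p)"
  have y: "opow A x (fact m) p = y p" if "p \<in> tests A" "m \<ge> M p" for p m
    using M[OF that] that by (simp add: y_def)
  have yO: "y \<in> Omega A"
  proof (rule OmegaI)
    show "y \<in> extensional (tests A)" by (simp add: y_def)
  next
    fix T \<phi> assume "(T, \<phi>) \<in> tests A"
    then show "y (T, \<phi>) \<in> carrier T" using Omega_carrier[OF opow_closed[OF x], of "(T, \<phi>)"] by (simp add: y_def)
  next
    fix T \<phi> S h assume t: "(T, \<phi>) \<in> tests A" "fin_monoid S" "h \<in> mon_hom T S"
    define m where "m = max (M (T, \<phi>)) (M (S, restrict (h \<circ> \<phi>) A))"
    have "y (T, \<phi>) = opow A x (fact m) (T, \<phi>)" using y[OF t(1), of m] by (simp add: m_def)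
    moreover have "y (S, restrict (h \<circ> \<phi>) A) = opow A x (fact m) (S, restrict (h \<circ> \<phi>) A)"
      using y[OF mon_hom_tests[OF t], of m] by (simp add: m_def)
    ultimately show "h (y (T, \<phi>)) = y (S, restrict (h \<circ> \<phi>) A)"
      using Omega_natural[OF opow_closed[OF x] t] by simp
  qed
  have lim: "limitin (OmegaTop A) (\<lambda>n. opow A x (fact n)) y sequentially"
    using y x by (intro limitin_OmegaTopI yO) auto
  have "omega_pow A x = y"
    unfolding omega_pow_def
  proof (rule the_equality)
    fix z assume "limitin (OmegaTop A) (\<lambda>n. opow A x (fact n)) z sequentially"
    then show "z = y" using lim trivial_limit_sequentially Hausdorff_OmegaTop by (rule limitin_Hausdorff_unique)
  qed (rule lim)
  then show "omega_pow A x \<in> Omega A"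
    "p \<in> tests A \<Longrightarrow> \<exists>m0. \<forall>m\<ge>m0. opow A x (fact m) p = omega_pow A x p"
    "limitin (OmegaTop A) (\<lambda>n. opow A x (fact n)) (omega_pow A x) sequentially"
    using yO y lim by blast+
qed

declare omega_pow_closed [simp]

lemma omega_pow_apply:
  assumes x: "x \<in> Omega A" and p: "p \<in> tests A"
  obtains m where "m \<ge> N" "omega_pow A x p = opow A x (fact m) p"
  using omega_pow_eventually[OF assms] by (metis nle_le)

text \<open>A common exponent for two omega powers, needed when both have to be replaced by powers
  of equal length.\<close>

lemma omega_pow_apply2:
  assumes x: "x \<in> Omega A" and y: "y \<in> Omega B" and p: "p \<in> tests A" and q: "q \<in> tests B"
  obtains m where "omega_pow A x p = opow A x (fact m) p" "omega_pow B y q = opow B y (fact m) q"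
  using omega_pow_eventually[OF x p] omega_pow_eventually[OF y q] by (metis nle_le)

lemma omega_pow_idem:
  assumes x: "x \<in> Omega A"
  shows "omult A (omega_pow A x) (omega_pow A x) = omega_pow A x"
proof (rule Omega_eqI)
  fix p assume p: "p \<in> tests A"
  obtain m0 where m0: "\<And>m. m \<ge> m0 \<Longrightarrow> opow A x (fact m) p = opow A x (fact m0) p"
    "opow A x (fact m0) p \<otimes>\<^bsub>fst p\<^esub> opow A x (fact m0) p = opow A x (fact m0) p"
    using opow_fact_stable[OF x p] by blast
  obtain m where "m \<ge> m0" "omega_pow A x p = opow A x (fact m) p"
    using omega_pow_apply[OF x p] .
  then have "omega_pow A x p = opow A x (fact m0) p" using m0(1) by metis
  then show "omult A (omega_pow A x) (omega_pow A x) p = omega_pow A x p" using p m0(2) by simp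
qed (use x in auto)

section \<open>Content and first and last occurrences in the free profinite monoid\<close>

text \<open>Level 0 of \<open>eqv\<close> compares exactly the contents, so the letters do not
  depend on the word chosen.\<close>

definition cont :: "nat set \<Rightarrow> pw \<Rightarrow> nat set" where
  "cont A u = set (SOME w. set w \<subseteq> A \<and> u (Qtest A 0) = code A 0 w)"

locale alphabet =
  fixes A :: "nat set"
  assumes finite_A [simp]: "finite A"
begin

lemma Qtest_code:
  assumes "u \<in> Omega A" "p \<in> tests A"
  obtains w where "set w \<subseteq> A" "u (Qtest A n) = code A n w" "wd A w p = u p"
  using words_dense2[OF assms Qtest_tests[OF finite_A, of n]] wd_Qtest[OF finite_A] by metis

lemma Qtest_code':
  assumes "u \<in> Omega A"
  obtains w where "set w \<subseteq> A" "u (Qtest A n) = code A n w"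
  using Qtest_code[OF assms Qtest_tests[OF finite_A]] by metis

text \<open>A word that agrees with \<open>u\<close> at both levels is equivalent to
  \<open>w\<close> at level \<open>n\<close>, hence also at level \<open>m\<close>.\<close>

lemma Qtest_code_mono:
  assumes u: "u \<in> Omega A" "u (Qtest A n) = code A n w" and w: "set w \<subseteq> A" and m: "m \<le> n"
  shows "u (Qtest A m) = code A m w"
proof -
  obtain w' where w': "set w' \<subseteq> A" "u (Qtest A n) = code A n w'" "wd A w' (Qtest A m) = u (Qtest A m)"
    using Qtest_code[OF u(1) Qtest_tests[OF finite_A]] by metis
  then have "eqv m w' w" using code_eq_iff[OF w'(1) w, of n] u(2) eqv_mono[OF _ m] by simp
  then show ?thesis using code_eq_iff[OF w'(1) w, of m] w' wd_Qtest[OF finite_A w'(1)] by simp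
qed

lemma cont_eq:
  assumes u: "u \<in> Omega A" "u (Qtest A n) = code A n w" and w: "set w \<subseteq> A"
  shows "cont A u = set w"
proof -
  let ?P = "\<lambda>w. set w \<subseteq> A \<and> u (Qtest A 0) = code A 0 w"
  have w0: "?P w" using Qtest_code_mono[OF u w, of 0] w by simp
  define v where "v = (SOME w. ?P w)"
  have "?P v" unfolding v_def using w0 by (rule someI)
  then have "eqv 0 v w" using code_eq_iff[of v A w 0] w0 by simp
  then show ?thesis by (simp add: cont_def v_def)
qed

lemma cont_cong: "u (Qtest A 0) = v (Qtest A 0) \<Longrightarrow> cont A u = cont A v"
  by (simp add: cont_def)

lemma cont_wd [simp]: "set w \<subseteq> A \<Longrightarrow> cont A (wd A w) = set w"
  using cont_eq[OF wd_closed wd_Qtest[OF finite_A]] by metis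

lemma cont_subset: "u \<in> Omega A \<Longrightarrow> cont A u \<subseteq> A"
  using Qtest_code' cont_eq by metis

lemma Qtest_omult:
  assumes "u (Qtest A n) = code A n x" "v (Qtest A n) = code A n y" "set x \<subseteq> A" "set y \<subseteq> A"
  shows "omult A u v (Qtest A n) = code A n (x @ y)"
  using assms by (simp add: Q_mult)

lemma cont_omult [simp]:
  assumes "u \<in> Omega A" "v \<in> Omega A"
  shows "cont A (omult A u v) = cont A u \<union> cont A v"
proof -
  obtain x where x: "set x \<subseteq> A" "u (Qtest A 0) = code A 0 x" using Qtest_code'[OF assms(1)] .
  obtain y where y: "set y \<subseteq> A" "v (Qtest A 0) = code A 0 y" using Qtest_code'[OF assms(2)] .
  show ?thesis
    using cont_eq[OF omult_closed[OF assms], of 0 "x @ y"] Qtest_omult[of u 0 x v y]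
      cont_eq[OF assms(1) x(2,1)] cont_eq[OF assms(2) y(2,1)] x y by simp
qed

lemma cont_oone [simp]: "cont A (oone A) = {}"
  using cont_wd[of "[]"] by simp

lemma cont_gen [simp]: "a \<in> A \<Longrightarrow> cont A (gen A a) = {a}"
  using cont_wd[of "[a]"] by simp

lemma cont_opow: "u \<in> Omega A \<Longrightarrow> n > 0 \<Longrightarrow> cont A (opow A u n) = cont A u"
proof (induction n)
  case (Suc n)
  then show ?case by (cases n) auto
qed simp

lemma cont_omega_pow [simp]:
  assumes "u \<in> Omega A"
  shows "cont A (omega_pow A u) = cont A u"
proof -
  obtain m where "omega_pow A u (Qtest A 0) = opow A u (fact m) (Qtest A 0)"
    using omega_pow_apply[OF assms Qtest_tests[OF finite_A]] by metis
  from cont_cong[of "omega_pow A u" "opow A u (fact m)", OF this] show ?thesis using cont_opow[OF assms] by simp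
qed

lemma cont_empty:
  assumes u: "u \<in> Omega A" "cont A u = {}"
  shows "u = oone A"
proof (rule Omega_eqI)
  fix p assume p: "p \<in> tests A"
  obtain w where w: "set w \<subseteq> A" "u (Qtest A 0) = code A 0 w" "wd A w p = u p" using Qtest_code[OF u(1) p] .
  then have "w = []" using cont_eq[OF u(1) w(2,1)] u(2) by simp
  then show "u p = oone A p" using w(3) p by simp
qed (use u in auto)

text \<open>The flag \<open>d\<close> selects one of the two mutually dual readings, from the left or from
  the right.\<close>

definition mu :: "bool \<Rightarrow> pw \<Rightarrow> pw \<Rightarrow> pw" where
  "mu d u v = (if d then omult A u v else omult A v u)"

definition ap :: "bool \<Rightarrow> 'a list \<Rightarrow> 'a list \<Rightarrow> 'a list" where
  "ap d x y = (if d then x @ y else y @ x)"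

lemma mu_closed [simp]: "u \<in> Omega A \<Longrightarrow> v \<in> Omega A \<Longrightarrow> mu d u v \<in> Omega A"
  by (simp add: mu_def)

lemma mu_assoc:
  "\<lbrakk>u \<in> Omega A; v \<in> Omega A; w \<in> Omega A\<rbrakk> \<Longrightarrow> mu d (mu d u v) w = mu d u (mu d v w)"
  by (simp add: mu_def omult_assoc)

lemma cont_mu [simp]: "\<lbrakk>u \<in> Omega A; v \<in> Omega A\<rbrakk> \<Longrightarrow> cont A (mu d u v) = cont A u \<union> cont A v"
  by (auto simp: mu_def)

lemma mu_cong: "\<lbrakk>u p = u' p; v p = v' p; p \<in> tests A\<rbrakk> \<Longrightarrow> mu d u v p = mu d u' v' p"
  by (simp add: mu_def)

lemma set_ap [simp]: "set (ap d x y) = set x \<union> set y"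
  by (auto simp: ap_def)

lemma wd_ap: "set x \<subseteq> A \<Longrightarrow> set y \<subseteq> A \<Longrightarrow> wd A (ap d x y) = mu d (wd A x) (wd A y)"
  by (simp add: ap_def mu_def)

lemma Qtest_mu:
  assumes "u (Qtest A n) = code A n x" "v (Qtest A n) = code A n y" "set x \<subseteq> A" "set y \<subseteq> A"
  shows "mu d u v (Qtest A n) = code A n (ap d x y)"
  using assms by (simp add: mu_def ap_def Q_mult)

lemma ap_split:
  assumes "a \<in> set w"
  obtains x y where "w = ap d x (ap d [a] y)" "a \<notin> set x"
proof (cases d)
  case True
  then show thesis using split_list_first[OF assms] that by (auto simp: ap_def)
next
  case False
  then show thesis using split_list_last[OF assms] that by (auto simp: ap_def)
qed

lemma eqv_SucD:
  assumes "eqv (Suc n) (ap d x (ap d [a] y)) (ap d x' (ap d [a] y'))" "a \<notin> set x" "a \<notin> set x'"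
  shows "eqv n x x' \<and> eqv n y y'"
proof (cases d)
  case True
  then show ?thesis using eqv_SucD_first[of n x a y x' y'] assms by (simp add: ap_def)
next
  case False
  then show ?thesis using eqv_SucD_last[of n y a x y' x'] assms by (simp add: ap_def)
qed

text \<open>Words approximating \<open>u\<close> contain \<open>a\<close> because content is read at
  level 0. Each is split at its first occurrence of \<open>a\<close> (last, if \<open>d\<close> is
  false), and the pairs of factors have a cluster point.\<close>

lemma factor_exists:
  assumes u: "u \<in> Omega A" and a: "a \<in> cont A u"
  obtains x y where "x \<in> Omega A" "y \<in> Omega A" "u = mu d x (mu d (gen A a) y)" "a \<notin> cont A x"
proof -
  have aA: "a \<in> A" using cont_subset[OF u] a by blast
  have "\<exists>x y. set x \<subseteq> A \<and> set y \<subseteq> A \<and> a \<notin> set x \<and> mu d (wd A x) (mu d (gen A a) (wd A y)) q = u q"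
    if q: "q \<in> tests A" for q
  proof -
    obtain w where w: "set w \<subseteq> A" "u (Qtest A 0) = code A 0 w" "wd A w q = u q" using Qtest_code[OF u q] .
    then have "a \<in> set w" using cont_eq[OF u w(2,1)] a by simp
    then obtain x y where xy: "w = ap d x (ap d [a] y)" "a \<notin> set x" using ap_split by metis
    then have "set x \<subseteq> A" "set y \<subseteq> A" using w by auto
    then have "wd A w = mu d (wd A x) (mu d (gen A a) (wd A y))" using xy aA by (simp add: wd_ap)
    then show ?thesis using w(3) xy \<open>set x \<subseteq> A\<close> \<open>set y \<subseteq> A\<close> by metis
  qed
  then obtain X Y where XY: "\<And>q. q \<in> tests A \<Longrightarrow> set (X q) \<subseteq> A \<and> set (Y q) \<subseteq> A \<and> a \<notin> set (X q) \<and>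
      mu d (wd A (X q)) (mu d (gen A a) (wd A (Y q))) q = u q" by metis
  define t where "t = (\<lambda>q i. if i = (0::nat) then wd A (X q) else wd A (Y q))"
  have "t q i \<in> Omega A" if "q \<in> tests A" "i < 2" for q i using XY that by (simp add: t_def)
  then obtain s where s: "\<And>i. i < 2 \<Longrightarrow> s i \<in> Omega A"
    "\<And>p. p \<in> tests A \<Longrightarrow> \<exists>q\<in>tests A. dominates A q p \<and> (\<forall>i<2. t q i p = s i p)"
    using Omega_cluster[of A 2 t] by metis
  have sO: "s 0 \<in> Omega A" "s 1 \<in> Omega A" using s(1) by auto
  show thesis
  proof (rule that[OF sO])
    show "u = mu d (s 0) (mu d (gen A a) (s 1))"
    proof (rule Omega_eqI)
      fix p assume p: "p \<in> tests A"
      then obtain q where q: "q \<in> tests A" "dominates A q p" "\<forall>i<2. t q i p = s i p" using s(2) by blast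
      have "t q 0 p = s 0 p" "t q 1 p = s 1 p" using q(3) by auto
      then have "wd A (X q) p = s 0 p" "wd A (Y q) p = s 1 p" by (auto simp: t_def)
      then have "mu d (s 0) (mu d (gen A a) (s 1)) p = mu d (wd A (X q)) (mu d (gen A a) (wd A (Y q))) p"
        using p by (intro mu_cong) auto
      moreover have "u p = mu d (wd A (X q)) (mu d (gen A a) (wd A (Y q))) p"
      proof (rule dominatesD[OF q(2) _ u])
        show "u q = mu d (wd A (X q)) (mu d (gen A a) (wd A (Y q))) q" using XY[OF q(1)] by (elim conjE) (rule sym)
        have "set (X q) \<subseteq> A" "set (Y q) \<subseteq> A" using XY[OF q(1)] by blast+
        then show "mu d (wd A (X q)) (mu d (gen A a) (wd A (Y q))) \<in> Omega A" using aA by simp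
      qed
      ultimately show "u p = mu d (s 0) (mu d (gen A a) (s 1)) p" by simp
    qed (use u sO aA in auto)
    \<comment> \<open>Absence of \<open>a\<close> is a condition at the single test
      \<open>Qtest A 0\<close>, so the cluster point inherits it.\<close>
    obtain q where q: "q \<in> tests A" "\<forall>i<2. t q i (Qtest A 0) = s i (Qtest A 0)"
      using s(2)[OF Qtest_tests[OF finite_A]] by blast
    have "t q 0 (Qtest A 0) = s 0 (Qtest A 0)" using q(2) by auto
    from cont_cong[of "t q 0" "s 0", OF this] have "cont A (s 0) = cont A (t q 0)" by (rule sym)
    then show "a \<notin> cont A (s 0)" using XY[OF q(1)] by (simp add: t_def)
  qed
qed

text \<open>One level is lost because \<open>eqv (Suc n)\<close> compares the factors of a split
  only at level \<open>n\<close>.\<close>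

lemma factor_code:
  assumes xy: "x \<in> Omega A" "y \<in> Omega A" "a \<in> A" "a \<notin> cont A x"
    and w: "set x' \<subseteq> A" "set y' \<subseteq> A" "a \<notin> set x'"
    and eq: "mu d x (mu d (gen A a) y) (Qtest A (Suc n)) = code A (Suc n) (ap d x' (ap d [a] y'))"
  shows "x (Qtest A n) = code A n x' \<and> y (Qtest A n) = code A n y'"
proof -
  obtain x'' where x'': "set x'' \<subseteq> A" "x (Qtest A (Suc n)) = code A (Suc n) x''" using Qtest_code'[OF xy(1)] .
  obtain y'' where y'': "set y'' \<subseteq> A" "y (Qtest A (Suc n)) = code A (Suc n) y''" using Qtest_code'[OF xy(2)] .
  have "mu d x (mu d (gen A a) y) (Qtest A (Suc n)) = code A (Suc n) (ap d x'' (ap d [a] y''))"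
    using xy(3) x'' y'' by (intro Qtest_mu) auto
  then have "eqv (Suc n) (ap d x'' (ap d [a] y'')) (ap d x' (ap d [a] y'))"
    using eq xy(3) x'' y'' w by (subst code_eq_iff[symmetric, of _ A]) auto
  moreover have "a \<notin> set x''" using cont_eq[OF xy(1) x''(2,1)] xy(4) by simp
  ultimately have "eqv n x'' x' \<and> eqv n y'' y'" using w(3) by (intro eqv_SucD)
  then show ?thesis
    using Qtest_code_mono[OF xy(1) x''(2,1), of n] Qtest_code_mono[OF xy(2) y''(2,1), of n]
      code_eq_iff x''(1) y''(1) w by auto
qed

text \<open>This is what validity on the models of either basis yields, since every
  \<open>Q A n\<close> is such a model.\<close>

definition equ :: "pw \<Rightarrow> pw \<Rightarrow> bool" where
  "equ u v \<longleftrightarrow> (\<forall>n. u (Qtest A n) = v (Qtest A n))"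

lemma equ_cont: "equ u v \<Longrightarrow> cont A u = cont A v"
  unfolding equ_def by (rule cont_cong) (erule allE)

text \<open>The loss of one level does no harm here because \<open>equ\<close> ranges over all
  levels.\<close>

lemma factor_equ:
  assumes "x \<in> Omega A" "y \<in> Omega A" "x' \<in> Omega A" "y' \<in> Omega A" "a \<in> A" "a \<notin> cont A x" "a \<notin> cont A x'"
    and eq: "equ (mu d x (mu d (gen A a) y)) (mu d x' (mu d (gen A a) y'))"
  shows "equ x x' \<and> equ y y'"
proof -
  have "x (Qtest A n) = x' (Qtest A n) \<and> y (Qtest A n) = y' (Qtest A n)" for n
  proof -
    obtain v where v: "set v \<subseteq> A" "x' (Qtest A (Suc n)) = code A (Suc n) v" using Qtest_code'[OF assms(3)] .
    obtain w where w: "set w \<subseteq> A" "y' (Qtest A (Suc n)) = code A (Suc n) w" using Qtest_code'[OF assms(4)] .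
    have "mu d x' (mu d (gen A a) y') (Qtest A (Suc n)) = code A (Suc n) (ap d v (ap d [a] w))"
      using assms(5) v w by (intro Qtest_mu) auto
    then have "mu d x (mu d (gen A a) y) (Qtest A (Suc n)) = code A (Suc n) (ap d v (ap d [a] w))"
      using eq by (simp add: equ_def)
    moreover have "a \<notin> set v" using cont_eq[OF assms(3) v(2,1)] assms(7) by simp
    ultimately have "x (Qtest A n) = code A n v \<and> y (Qtest A n) = code A n w"
      using factor_code[OF assms(1,2,5,6) v(1) w(1)] by blast
    then show ?thesis
      using Qtest_code_mono[OF assms(3) v(2,1), of n] Qtest_code_mono[OF assms(4) w(2,1), of n] by simp
  qed
  then show ?thesis by (simp add: equ_def)
qed

text \<open>The letter is the last one to make its first appearance in the given reading direction.
  Appending a letter to a word either makes it that letter or only lengthens the final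
  factor.\<close>

lemma last_new_letter:
  "w \<noteq> [] \<Longrightarrow> \<exists>a x y. w = ap d x (ap d [a] y) \<and> a \<notin> set x \<and> set x = set w - {a}"
proof -
  have left: "w \<noteq> [] \<Longrightarrow> \<exists>a x y. w = x @ a # y \<and> a \<notin> set x \<and> set x = set w - {a}" for w :: "'a list"
  proof (induction w rule: rev_induct)
    case (snoc b w)
    show ?case
    proof (cases "b \<in> set w")
      case False
      then show ?thesis by (intro exI[of _ b] exI[of _ w] exI[of _ "[]"]) auto
    next
      case True
      then have "w \<noteq> []" by auto
      from snoc.IH[OF this] obtain a x y where "w = x @ a # y" "a \<notin> set x" "set x = set w - {a}" by blast
      moreover have "set (w @ [b]) = set w" using True by auto
      ultimately have "w @ [b] = x @ a # (y @ [b]) \<and> a \<notin> set x \<and> set x = set (w @ [b]) - {a}"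
        by (metis append_Cons append_assoc)
      then show ?thesis by blast
    qed
  qed simp
  assume w: "w \<noteq> []"
  show ?thesis
  proof (cases d)
    case True
    then show ?thesis using left[OF w] by (simp add: ap_def)
  next
    case False
    have "rev w \<noteq> []" using w by simp
    from left[OF this] obtain a x y where h: "rev w = x @ a # y" "a \<notin> set x" "set x = set (rev w) - {a}" by blast
    have "w = rev y @ [a] @ rev x" using h(1) by (simp add: rev_swap)
    then have "w = ap d (rev x) (ap d [a] (rev y))" using False by (simp add: ap_def)
    moreover have "a \<notin> set (rev x)" "set (rev x) = set w - {a}" using h(2,3) by (simp_all only: set_rev not_False_eq_True)
    ultimately show ?thesis by blast
  qed
qed

lemma basic_factorization:
  assumes u: "u \<in> Omega A" and ne: "cont A u \<noteq> {}"
  obtains a x y where "a \<in> cont A u" "x \<in> Omega A" "y \<in> Omega A" "u = mu d x (mu d (gen A a) y)"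
    "cont A x = cont A u - {a}"
proof -
  \<comment> \<open>Level 1 is enough: the split costs one level, and the content of
    \<open>x\<close> is read at level 0.\<close>
  obtain w where w: "set w \<subseteq> A" "u (Qtest A 1) = code A 1 w" using Qtest_code'[OF u] .
  have cw: "cont A u = set w" using cont_eq[OF u w(2,1)] .
  then have "w \<noteq> []" using ne by auto
  from last_new_letter[OF this]
  obtain a x' y' where f: "w = ap d x' (ap d [a] y')" "a \<notin> set x'" "set x' = set w - {a}" by blast
  have "set w = set x' \<union> {a} \<union> set y'" unfolding f(1) by simp
  then have a: "a \<in> cont A u" "a \<in> A" and s: "set x' \<subseteq> A" "set y' \<subseteq> A" using w(1) cw by auto
  obtain x y where xy: "x \<in> Omega A" "y \<in> Omega A" "u = mu d x (mu d (gen A a) y)" "a \<notin> cont A x"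
    using factor_exists[OF u a(1)] .
  have "x (Qtest A 0) = code A 0 x'"
    using factor_code[OF xy(1,2) a(2) xy(4) s f(2), of d 0] w(2) f(1) xy(3) by simp
  then have "cont A x = set x'" using cont_eq[OF xy(1) _ s(1)] by blast
  then show thesis using that[OF a(1) xy(1-3)] f(3) cw by simp
qed

end

section \<open>Closed quotients in which idempotents absorb their factors\<close>

text \<open>\<open>pi_limit\<close> is closedness of the kernel of \<open>\<pi>\<close>: a pair that
  identified elements match at each test is itself identified. The monoid itself carries no
  topology.\<close>

locale closed_quotient = alphabet A + S: monoid S for A and S (structure) +
  fixes \<pi> :: "pw \<Rightarrow> 'c"
  assumes carrier_S: "carrier S = \<pi> ` Omega A"
    and pi_one [simp]: "\<pi> (oone A) = \<one>"
    and pi_mult [simp]: "\<lbrakk>u \<in> Omega A; v \<in> Omega A\<rbrakk> \<Longrightarrow> \<pi> (omult A u v) = \<pi> u \<otimes> \<pi> v"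
    and pi_limit: "\<lbrakk>u \<in> Omega A; v \<in> Omega A;
        \<And>p. p \<in> tests A \<Longrightarrow> \<exists>w\<in>Omega A. \<exists>z\<in>Omega A. w p = u p \<and> z p = v p \<and> \<pi> w = \<pi> z\<rbrakk>
      \<Longrightarrow> \<pi> u = \<pi> v"
begin

lemma pi_closed [simp]: "u \<in> Omega A \<Longrightarrow> \<pi> u \<in> carrier S"
  by (simp add: carrier_S)

lemma pi_opow:
  assumes "x \<in> Omega A"
  shows "\<pi> (opow A x n) = \<pi> x [^] n"
proof (induction n)
  case (Suc n)
  then show ?case using assms S.nat_pow_Suc2[of "\<pi> x" n] by simp
qed simp

text \<open>All positive powers of \<open>x\<close> have the same image as \<open>x\<close>, and
  closedness passes this on to the limit.\<close>

lemma pi_omega_pow_idem: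
  assumes x: "x \<in> Omega A" and idem: "\<pi> x \<otimes> \<pi> x = \<pi> x"
  shows "\<pi> (omega_pow A x) = \<pi> x"
proof (rule pi_limit)
  have pow: "\<pi> x [^] Suc k = \<pi> x" for k
    using x idem by (induction k) auto
  fix p assume p: "p \<in> tests A"
  obtain m where "omega_pow A x p = opow A x (fact m) p"
    using omega_pow_apply[OF x p] .
  moreover have "\<pi> (opow A x (fact m)) = \<pi> x"
    using pow[of "fact m - 1"] pi_opow[OF x, of "fact m"] by simp
  ultimately show "\<exists>w\<in>Omega A. \<exists>z\<in>Omega A. w p = omega_pow A x p \<and> z p = x p \<and> \<pi> w = \<pi> z"
    using x by (intro bexI[of _ "opow A x (fact m)"] bexI[of _ x]) auto
qed (use x in auto)

text \<open>The hypothesis removes one factor of each kind from the inside of a product of equal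
  powers, \<open>x x y y\<close> being \<open>x y\<close> in the quotient. Equal exponents at each
  test carry this over to the omega powers.\<close>

lemma pi_omega_pow_prod:
  assumes x: "x \<in> Omega A" and y: "y \<in> Omega A" and e: "\<pi> x \<otimes> \<pi> y \<otimes> \<pi> y = \<pi> y"
  shows "\<pi> (omega_pow A x) \<otimes> \<pi> (omega_pow A y) = \<pi> x \<otimes> \<pi> y"
proof -
  have pow: "\<pi> x [^] Suc k \<otimes> \<pi> y [^] Suc k = \<pi> x \<otimes> \<pi> y" for k
  proof (induction k)
    case 0
    then show ?case using x y by simp
  next
    case (Suc k)
    have "\<pi> x [^] Suc (Suc k) \<otimes> \<pi> y [^] Suc (Suc k) = \<pi> x \<otimes> (\<pi> x [^] Suc k \<otimes> \<pi> y [^] Suc k) \<otimes> \<pi> y"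
      unfolding S.nat_pow_Suc2[OF pi_closed[OF x], of "Suc k"] S.nat_pow_Suc[of "\<pi> y" "Suc k"]
      using x y by (simp only: S.m_assoc pi_closed S.m_closed S.nat_pow_closed)
    also have "\<dots> = \<pi> x \<otimes> (\<pi> x \<otimes> \<pi> y \<otimes> \<pi> y)" unfolding Suc using x y by (simp add: S.m_assoc)
    finally show ?case unfolding e .
  qed
  have "\<pi> (omult A (omega_pow A x) (omega_pow A y)) = \<pi> (omult A x y)"
  proof (rule pi_limit)
    fix p assume p: "p \<in> tests A"
    obtain m where m: "omega_pow A x p = opow A x (fact m) p" "omega_pow A y p = opow A y (fact m) p"
      using omega_pow_apply2[OF x y p p] .
    have "\<pi> (omult A (opow A x (fact m)) (opow A y (fact m))) = \<pi> (omult A x y)"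
      using pow[of "fact m - 1"] pi_opow[OF x, of "fact m"] pi_opow[OF y, of "fact m"] x y by simp
    then show "\<exists>w\<in>Omega A. \<exists>z\<in>Omega A. w p = omult A (omega_pow A x) (omega_pow A y) p \<and>
        z p = omult A x y p \<and> \<pi> w = \<pi> z"
      using x y p m by (intro bexI[of _ "omult A (opow A x (fact m)) (opow A y (fact m))"] bexI[of _ "omult A x y"]) auto
  qed (use x y in auto)
  then show ?thesis using x y by simp
qed

lemma pi_mu: "\<lbrakk>u \<in> Omega A; v \<in> Omega A\<rbrakk> \<Longrightarrow> \<pi> (mu d u v) = (if d then \<pi> u \<otimes> \<pi> v else \<pi> v \<otimes> \<pi> u)"
  by (simp add: mu_def)

lemma mu_omega_pow:
  assumes x: "x \<in> Omega A" and z: "z \<in> Omega A" and eq: "mu d x z = x"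
  shows "mu d x (omega_pow A z) = x"
proof (rule Omega_eqI)
  have pow: "mu d x (opow A z k) = x" for k
  proof (induction k)
    case 0
    then show ?case using x by (simp add: mu_def)
  next
    case (Suc k)
    have "opow A z (Suc k) = mu True z (opow A z k)" by (simp add: mu_def)
    \<comment> \<open>\<open>opow\<close> multiplies on the left. Powers of \<open>z\<close> commute
      with \<open>z\<close>, which makes both readings available.\<close>
    moreover have "mu True z (opow A z k) = mu False z (opow A z k)"
    proof (induction k)
      case 0
      show ?case using z by (simp add: mu_def)
    next
      case (Suc k)
      then show ?case using z omult_assoc[of z A "opow A z k" z] by (simp add: mu_def)
    qed
    ultimately have "opow A z (Suc k) = mu d z (opow A z k)" by (cases d) auto
    then show ?case using mu_assoc[of x z "opow A z k" d] x z eq Suc by simp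
  qed
  fix p assume p: "p \<in> tests A"
  obtain m where "omega_pow A z p = opow A z (fact m) p" using omega_pow_apply[OF z p] .
  then have "mu d x (omega_pow A z) p = mu d x (opow A z (fact m)) p" using p by (intro mu_cong) auto
  then show "mu d x (omega_pow A z) p = x p" by (simp add: pow)
qed (use x z in auto)

end

text \<open>From \<open>x \<otimes> e = x\<close> and the absorption of \<open>u'\<close> follows
  \<open>u \<otimes> e = x\<close>; dually \<open>f \<otimes> u = x'\<close>. Inserting
  \<open>e \<otimes> (f \<otimes> u) \<otimes> e\<close> for \<open>e\<close> in
  \<open>u = u \<otimes> e \<otimes> u'\<close> leaves \<open>x \<otimes> (f \<otimes> u)\<close>.
  The outcome depends on the two ends only.\<close>

lemma (in monoid) factorization_through_ends:
  assumes c: "u \<in> carrier G" "x \<in> carrier G" "x' \<in> carrier G" "u' \<in> carrier G" "u'' \<in> carrier G"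
      "e \<in> carrier G" "f \<in> carrier G"
    and u: "u = x \<otimes> u'" "u = u'' \<otimes> x'" and x: "x \<otimes> e = x" "f \<otimes> x' = x'"
    and e: "e \<otimes> u' \<otimes> e = e" "f \<otimes> u'' \<otimes> f = f" "e \<otimes> (f \<otimes> u) \<otimes> e = e"
  shows "u = x \<otimes> x'"
proof -
  have "u \<otimes> e = x \<otimes> e \<otimes> u' \<otimes> e" using u(1) x(1) by simp
  also have "\<dots> = x \<otimes> (e \<otimes> u' \<otimes> e)" using c by (simp add: m_assoc)
  finally have ue: "u \<otimes> e = x" using e x by simp
  have "f \<otimes> u = f \<otimes> (u'' \<otimes> (f \<otimes> x'))" using u(2) x(2) by simp
  also have "\<dots> = (f \<otimes> u'' \<otimes> f) \<otimes> x'" using c by (simp add: m_assoc)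
  finally have fu: "f \<otimes> u = x'" using e x by simp
  have "u = u \<otimes> e \<otimes> u'" using ue u(1) by simp
  also have "\<dots> = u \<otimes> (e \<otimes> (f \<otimes> u) \<otimes> e) \<otimes> u'" using e(3) by simp
  also have "\<dots> = (u \<otimes> e) \<otimes> (f \<otimes> ((u \<otimes> e) \<otimes> u'))" using c by (simp add: m_assoc)
  also have "\<dots> = x \<otimes> x'" using ue u(1) fu by simp
  finally show ?thesis .
qed

text \<open>For finite monoids this condition describes DA: an idempotent absorbs each of its
  factors.\<close>

locale absorbing_quotient = closed_quotient +
  assumes absorb_factor: "\<lbrakk>e \<in> carrier S; p \<in> carrier S; a \<in> carrier S; q \<in> carrier S;
      e \<otimes> e = e; e = p \<otimes> a \<otimes> q\<rbrakk> \<Longrightarrow> e \<otimes> a \<otimes> e = e"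
begin

lemma absorb_letter:
  assumes w: "w \<in> Omega A" "\<pi> w \<otimes> \<pi> w = \<pi> w" and a: "a \<in> cont A w"
  shows "\<pi> w \<otimes> \<pi> (gen A a) \<otimes> \<pi> w = \<pi> w"
proof -
  have aA: "a \<in> A" using cont_subset[OF w(1)] a by blast
  obtain x y where "x \<in> Omega A" "y \<in> Omega A" "w = mu True x (mu True (gen A a) y)"
    using factor_exists[OF w(1) a] .
  then show ?thesis
    using absorb_factor[of "\<pi> w" "\<pi> x" "\<pi> (gen A a)" "\<pi> y"] w aA by (simp add: pi_mu S.m_assoc)
qed

text \<open>Once \<open>w\<close> absorbs \<open>s\<close>, the product of \<open>w\<close> and
  \<open>s\<close> is again idempotent in the quotient and still contains all letters of
  \<open>w\<close>. It therefore absorbs the next letter.\<close>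

lemma absorb_word:
  assumes w: "w \<in> Omega A" "\<pi> w \<otimes> \<pi> w = \<pi> w" and "set s \<subseteq> cont A w"
  shows "\<pi> w \<otimes> \<pi> (wd A s) \<otimes> \<pi> w = \<pi> w"
  using assms(3)
proof (induction s rule: rev_induct)
  case Nil
  then show ?case using w by simp
next
  case (snoc a s)
  have A: "a \<in> A" "set s \<subseteq> A" using snoc.prems cont_subset[OF w(1)] by auto
  let ?a = "\<pi> (gen A a)" and ?s = "\<pi> (wd A s)" and ?w = "\<pi> w"
  let ?f = "omult A w (wd A s)"
  have IH: "?w \<otimes> ?s \<otimes> ?w = ?w" using snoc by simp
  have f: "?f \<in> Omega A" "\<pi> ?f = ?w \<otimes> ?s" using w A by auto
  have "\<pi> ?f \<otimes> \<pi> ?f = (?w \<otimes> ?s \<otimes> ?w) \<otimes> ?s" unfolding f(2) using w A by (simp add: S.m_assoc)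
  then have "\<pi> ?f \<otimes> \<pi> ?f = \<pi> ?f" using IH f by simp
  moreover have "a \<in> cont A ?f" using w A snoc.prems by simp
  ultimately have "\<pi> ?f \<otimes> ?a \<otimes> \<pi> ?f = \<pi> ?f" using absorb_letter f by blast
  then have "(?w \<otimes> ?s \<otimes> ?a \<otimes> (?w \<otimes> ?s)) \<otimes> ?w = (?w \<otimes> ?s) \<otimes> ?w" unfolding f by simp
  moreover have "(?w \<otimes> ?s \<otimes> ?a \<otimes> (?w \<otimes> ?s)) \<otimes> ?w = ?w \<otimes> (?s \<otimes> ?a) \<otimes> (?w \<otimes> ?s \<otimes> ?w)"
    using w A by (simp add: S.m_assoc)
  ultimately show ?case using IH w A by simp
qed

text \<open>\<open>x\<close> is approximated by words that also agree with it at level 0, so their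
  letters stay inside the content of \<open>w\<close>.\<close>

lemma absorb:
  assumes w: "w \<in> Omega A" "\<pi> w \<otimes> \<pi> w = \<pi> w" and x: "x \<in> Omega A" "cont A x \<subseteq> cont A w"
  shows "\<pi> w \<otimes> \<pi> x \<otimes> \<pi> w = \<pi> w"
proof -
  have "\<pi> (omult A (omult A w x) w) = \<pi> w"
  proof (rule pi_limit)
    fix p assume p: "p \<in> tests A"
    obtain s where s: "set s \<subseteq> A" "x (Qtest A 0) = code A 0 s" "wd A s p = x p" using Qtest_code[OF x(1) p] .
    have "set s \<subseteq> cont A w" using cont_eq[OF x(1) s(2,1)] x(2) by simp
    then have "\<pi> (omult A (omult A w (wd A s)) w) = \<pi> w" using absorb_word[OF w] w s by simp
    then show "\<exists>v\<in>Omega A. \<exists>z\<in>Omega A. v p = omult A (omult A w x) w p \<and> z p = w p \<and> \<pi> v = \<pi> z"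
      using s p w x by (intro bexI[of _ "omult A (omult A w (wd A s)) w"] bexI[of _ w]) auto
  qed (use w x in auto)
  then show ?thesis using w x by simp
qed

text \<open>One step of the iterated basic factorization: as long as \<open>\<pi>\<close> separates \<open>u\<close>
  from \<open>v\<close>, the remainder has full content, since otherwise the induction hypothesis applies
  to it.\<close>

lemma factorization_step:
  assumes IH: "\<And>u v. \<lbrakk>u \<in> Omega A; v \<in> Omega A; equ u v; cont A u \<subset> C\<rbrakk> \<Longrightarrow> \<pi> u = \<pi> v"
    and uv: "u \<in> Omega A" "v \<in> Omega A" "equ u v" "cont A u = C" "\<pi> u \<noteq> \<pi> v"
  obtains x y u' v' where "x \<in> Omega A" "y \<in> Omega A" "u' \<in> Omega A" "v' \<in> Omega A"
    "u = mu d x u'" "v = mu d y v'" "\<pi> x = \<pi> y" "cont A x = C"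
    "cont A u' = C" "equ u' v'" "\<pi> u' \<noteq> \<pi> v'"
proof -
  have "C \<noteq> {}"
  proof
    assume "C = {}"
    then have "u = oone A" "v = oone A" using cont_empty uv equ_cont[OF uv(3)] by auto
    then show False using uv by simp
  qed
  then have "cont A u \<noteq> {}" using uv(4) by simp
  then obtain a x u' where u: "a \<in> cont A u" "x \<in> Omega A" "u' \<in> Omega A" "u = mu d x (mu d (gen A a) u')"
    "cont A x = cont A u - {a}"
    by (rule basic_factorization[OF uv(1)])
  have a: "a \<in> C" "a \<in> cont A v" using u(1) unfolding equ_cont[OF uv(3), symmetric] uv(4) by simp_all
  have aA: "a \<in> A" using u(1) cont_subset[OF uv(1)] by (rule subsetD[rotated])
  obtain y v' where v: "y \<in> Omega A" "v' \<in> Omega A" "v = mu d y (mu d (gen A a) v')" "a \<notin> cont A y"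
    using factor_exists[OF uv(2) a(2)] .
  have ax: "a \<notin> cont A x" unfolding u(5) by simp
  have equ: "equ x y" "equ u' v'"
    using factor_equ[OF u(2,3) v(1,2) aA ax v(4), of d] uv(3) unfolding u(4)[symmetric] v(3)[symmetric] by blast+
  \<comment> \<open>The prefix before the new letter \<open>a\<close> misses \<open>a\<close>, so
    the induction hypothesis identifies it with its counterpart \<open>y\<close>.\<close>
  have "cont A x \<subset> C" unfolding u(5) uv(4) using a(1) by blast
  then have xy: "\<pi> x = \<pi> y" using equ by (intro IH u v)
  have O: "mu d x (gen A a) \<in> Omega A" "mu d y (gen A a) \<in> Omega A" using u(2) v(1) aA by simp_all
  have u': "u = mu d (mu d x (gen A a)) u'" unfolding u(4) using u(2,3) aA by (simp add: mu_assoc)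
  have v': "v = mu d (mu d y (gen A a)) v'" unfolding v(3) using v(1,2) aA by (simp add: mu_assoc)
  have pi: "\<pi> (mu d x (gen A a)) = \<pi> (mu d y (gen A a))" using u(2) v(1) aA xy by (simp add: pi_mu)
  have neq: "\<pi> u' \<noteq> \<pi> v'"
  proof
    assume "\<pi> u' = \<pi> v'"
    then have "\<pi> (mu d (mu d x (gen A a)) u') = \<pi> (mu d (mu d y (gen A a)) v')"
      unfolding pi_mu[OF O(1) u(3)] pi_mu[OF O(2) v(2)] pi by simp
    then show False using uv(5) unfolding u'[symmetric] v'[symmetric] by simp
  qed
  have full: "cont A u' = C"
  proof (rule ccontr)
    assume "cont A u' \<noteq> C"
    moreover have "cont A u' \<subseteq> C" using arg_cong[OF u(4), of "cont A"] u(2,3) aA unfolding uv(4) by auto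
    ultimately have "\<pi> u' = \<pi> v'" using equ by (intro IH u v psubsetI)
    then show False using neq by simp
  qed
  have "cont A (mu d x (gen A a)) = C" using u(2) aA a(1) unfolding cont_mu[OF u(2) gen_closed[OF aA]] u(5) uv(4) by auto
  from that[OF O u(3) v(2) u' v' pi this full equ(2) neq] show thesis .
qed

text \<open>If the factorization never stops, the accumulated prefixes have a cluster point that is
  stabilized by an element of full content.  At each test this is the pigeonhole principle in
  the finite monoid, and compactness makes it uniform.\<close>

lemma infinite_factorization:
  assumes IH: "\<And>u v. \<lbrakk>u \<in> Omega A; v \<in> Omega A; equ u v; cont A u \<subset> C\<rbrakk> \<Longrightarrow> \<pi> u = \<pi> v"
    and uv: "u \<in> Omega A" "v \<in> Omega A" "equ u v" "cont A u = C" "\<pi> u \<noteq> \<pi> v"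
  obtains x y z u' v' where "x \<in> Omega A" "y \<in> Omega A" "z \<in> Omega A" "u' \<in> Omega A" "v' \<in> Omega A"
    "u = mu d x u'" "v = mu d y v'" "\<pi> x = \<pi> y" "mu d x z = x"
    "cont A z = C" "cont A u' = C" "cont A v' = C"
proof -
  \<comment> \<open>The state holds the accumulated prefixes of \<open>u\<close> and
    \<open>v\<close> and the remainders, which are still separated by \<open>\<pi>\<close>.
    \<open>R\<close> records that a step extends the prefix by a factor of full content.\<close>
  define P where "P = (\<lambda>(x, y, u', v'). x \<in> Omega A \<and> y \<in> Omega A \<and> u' \<in> Omega A \<and> v' \<in> Omega A \<and>
    u = mu d x u' \<and> v = mu d y v' \<and> \<pi> x = \<pi> y \<and> cont A u' = C \<and> equ u' v' \<and> \<pi> u' \<noteq> \<pi> v')"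
  define R where "R = (\<lambda>(s :: pw \<times> pw \<times> pw \<times> pw) (s' :: pw \<times> pw \<times> pw \<times> pw). \<exists>z. z \<in> Omega A \<and> cont A z = C \<and> fst s' = mu d (fst s) z)"
  have "P (oone A, oone A, u, v)" using uv by (simp add: P_def mu_def)
  moreover have "\<exists>s'. P s' \<and> R s s'" if s: "P s" for s
  proof -
    obtain x y u' v' where s': "s = (x, y, u', v')" by (cases s)
    have h: "x \<in> Omega A" "y \<in> Omega A" "u' \<in> Omega A" "v' \<in> Omega A" "u = mu d x u'" "v = mu d y v'"
      "\<pi> x = \<pi> y" "cont A u' = C" "equ u' v'" "\<pi> u' \<noteq> \<pi> v'"
      using s unfolding s' P_def by auto
    obtain x1 y1 u1 v1 where k: "x1 \<in> Omega A" "y1 \<in> Omega A" "u1 \<in> Omega A" "v1 \<in> Omega A"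
      "u' = mu d x1 u1" "v' = mu d y1 v1" "\<pi> x1 = \<pi> y1" "cont A x1 = C"
      "cont A u1 = C" "equ u1 v1" "\<pi> u1 \<noteq> \<pi> v1"
      by (rule factorization_step[OF IH h(3,4,9,8,10)])
    have "u = mu d (mu d x x1) u1" "v = mu d (mu d y y1) v1" using h k by (simp_all add: mu_assoc)
    moreover have "\<pi> (mu d x x1) = \<pi> (mu d y y1)" using h k by (simp add: pi_mu)
    ultimately have "P (mu d x x1, mu d y y1, u1, v1)" unfolding P_def using h(1,2) k by simp
    moreover have "R s (mu d x x1, mu d y y1, u1, v1)" using k by (auto simp: R_def s')
    ultimately show ?thesis by blast
  qed
  ultimately obtain f :: "nat \<Rightarrow> pw \<times> pw \<times> pw \<times> pw" where f: "\<And>n. P (f n)" "\<And>n. R (f n) (f (Suc n))"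
    using dependent_nat_choice[of "\<lambda>_. P" "\<lambda>_. R"] by metis
  have fO: "fst (f n) \<in> Omega A" for n using f(1)[of n] by (auto simp: P_def)
  have seg: "\<exists>z. z \<in> Omega A \<and> cont A z = C \<and> fst (f (Suc (i + k))) = mu d (fst (f i)) z" for i k
  proof (induction k)
    case 0
    then show ?case using f(2)[of i] by (simp add: R_def)
  next
    case (Suc k)
    then obtain z where z: "z \<in> Omega A" "cont A z = C" "fst (f (Suc (i + k))) = mu d (fst (f i)) z" by blast
    obtain z' where z': "z' \<in> Omega A" "cont A z' = C" "fst (f (Suc (Suc (i + k)))) = mu d (fst (f (Suc (i + k)))) z'"
      using f(2)[of "Suc (i + k)"] by (auto simp: R_def)
    have "fst (f (Suc (i + Suc k))) = mu d (fst (f i)) (mu d z z')"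
      using z z' fO by (simp add: mu_assoc)
    then show ?case using z(1,2) z'(1,2) by (intro exI[of _ "mu d z z'"]) simp
  qed
  have "\<exists>n z. z \<in> Omega A \<and> cont A z = C \<and> mu d (fst (f n)) z p = fst (f n) p" if p: "p \<in> tests A" for p
  proof -
    have "range (\<lambda>n. fst (f n) p) \<subseteq> carrier (fst p)" using Omega_carrier[OF fO p] by blast
    then have "\<not> inj (\<lambda>n. fst (f n) p)" using finite_subset[OF _ tests_finite[OF p]] finite_imageD infinite_UNIV_nat by blast
    then obtain i j where "i < j" "fst (f i) p = fst (f j) p" unfolding inj_def by (metis nat_neq_iff)
    then obtain k where "fst (f i) p = fst (f (Suc (i + k))) p" using less_imp_Suc_add by blast
    moreover obtain z where "z \<in> Omega A" "cont A z = C" "fst (f (Suc (i + k))) = mu d (fst (f i)) z" using seg by blast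
    ultimately show ?thesis by metis
  qed
  then obtain N Z where NZ: "\<And>p. p \<in> tests A \<Longrightarrow> Z p \<in> Omega A \<and> cont A (Z p) = C \<and> mu d (fst (f (N p))) (Z p) p = fst (f (N p)) p"
    by metis
  \<comment> \<open>Prefixes, stabilizer and remainders are packed into one tuple so that all five
    limits are taken along the same net.\<close>
  define t where "t = (\<lambda>p i. case f (N p) of (x, y, u', v') \<Rightarrow> [x, y, Z p, u', v'] ! i)"
  have t: "t q 0 \<in> Omega A" "t q 1 \<in> Omega A" "t q 2 \<in> Omega A" "t q 3 \<in> Omega A" "t q 4 \<in> Omega A"
      "u = mu d (t q 0) (t q 3)" "v = mu d (t q 1) (t q 4)" "\<pi> (t q 0) = \<pi> (t q 1)"
      "cont A (t q 2) = C" "cont A (t q 3) = C" "cont A (t q 4) = C" "mu d (t q 0) (t q 2) q = t q 0 q"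
    if q: "q \<in> tests A" for q
  proof -
    obtain x y u' v' where fq: "f (N q) = (x, y, u', v')" by (cases "f (N q)")
    have h: "x \<in> Omega A" "y \<in> Omega A" "u' \<in> Omega A" "v' \<in> Omega A" "u = mu d x u'" "v = mu d y v'"
      "\<pi> x = \<pi> y" "cont A u' = C" "equ u' v'"
      using f(1)[of "N q"] unfolding fq P_def by auto
    have tq: "t q 0 = x" "t q 1 = y" "t q 2 = Z q" "t q 3 = u'" "t q 4 = v'"
      by (simp_all add: t_def fq)
    have "cont A v' = C" using equ_cont[OF h(9)] h(8) by simp
    then show "t q 0 \<in> Omega A" "t q 1 \<in> Omega A" "t q 2 \<in> Omega A" "t q 3 \<in> Omega A" "t q 4 \<in> Omega A"
      "u = mu d (t q 0) (t q 3)" "v = mu d (t q 1) (t q 4)" "\<pi> (t q 0) = \<pi> (t q 1)"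
      "cont A (t q 2) = C" "cont A (t q 3) = C" "cont A (t q 4) = C" "mu d (t q 0) (t q 2) q = t q 0 q"
      unfolding tq using h NZ[OF q] fq by simp_all
  qed
  have "t q i \<in> Omega A" if "q \<in> tests A" "i < 5" for q i
  proof -
    have "i = 0 \<or> i = 1 \<or> i = 2 \<or> i = 3 \<or> i = 4" using that(2) by linarith
    then show ?thesis using t(1-5)[OF that(1)] by blast
  qed
  then obtain s where s: "\<And>i. i < 5 \<Longrightarrow> s i \<in> Omega A"
    "\<And>p. p \<in> tests A \<Longrightarrow> \<exists>q\<in>tests A. dominates A q p \<and> (\<forall>i<5. t q i p = s i p)"
    using Omega_cluster[of A 5 t] by blast
  have sO: "s 0 \<in> Omega A" "s 1 \<in> Omega A" "s 2 \<in> Omega A" "s 3 \<in> Omega A" "s 4 \<in> Omega A" using s(1) by simp_all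
  have s2: "\<exists>q\<in>tests A. dominates A q p \<and> t q 0 p = s 0 p \<and> t q 1 p = s 1 p \<and> t q 2 p = s 2 p \<and> t q 3 p = s 3 p \<and> t q 4 p = s 4 p"
    if p: "p \<in> tests A" for p
    using s(2)[OF p] by (meson numeral_less_iff semiring_norm zero_less_numeral one_less_numeral_iff)
  obtain q0 where q0: "q0 \<in> tests A" "t q0 2 (Qtest A 0) = s 2 (Qtest A 0)" "t q0 3 (Qtest A 0) = s 3 (Qtest A 0)"
    "t q0 4 (Qtest A 0) = s 4 (Qtest A 0)"
    using s2[OF Qtest_tests[OF finite_A, of 0]] by blast
  show thesis
  proof (rule that[OF sO])
    show "u = mu d (s 0) (s 3)"
    proof (rule Omega_eqI)
      fix p assume p: "p \<in> tests A"
      then obtain q where q: "q \<in> tests A" "t q 0 p = s 0 p" "t q 3 p = s 3 p" using s2 by blast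
      have "mu d (s 0) (s 3) p = mu d (t q 0) (t q 3) p" using q p by (intro mu_cong) auto
      then show "u p = mu d (s 0) (s 3) p" using t(6)[OF q(1)] by metis
    qed (use uv sO in auto)
    show "v = mu d (s 1) (s 4)"
    proof (rule Omega_eqI)
      fix p assume p: "p \<in> tests A"
      then obtain q where q: "q \<in> tests A" "t q 1 p = s 1 p" "t q 4 p = s 4 p" using s2 by blast
      have "mu d (s 1) (s 4) p = mu d (t q 1) (t q 4) p" using q p by (intro mu_cong) auto
      then show "v p = mu d (s 1) (s 4) p" using t(7)[OF q(1)] by metis
    qed (use uv sO in auto)
    show "\<pi> (s 0) = \<pi> (s 1)"
    proof (rule pi_limit[OF sO(1,2)])
      fix p assume "p \<in> tests A"
      then obtain q where "q \<in> tests A" "t q 0 p = s 0 p" "t q 1 p = s 1 p" using s2 by blast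
      then show "\<exists>w\<in>Omega A. \<exists>z\<in>Omega A. w p = s 0 p \<and> z p = s 1 p \<and> \<pi> w = \<pi> z"
        using t(1,2,8) by blast
    qed
    show "mu d (s 0) (s 2) = s 0"
    proof (rule Omega_eqI)
      fix p assume p: "p \<in> tests A"
      then obtain q where q: "q \<in> tests A" "dominates A q p" "t q 0 p = s 0 p" "t q 2 p = s 2 p" using s2 by blast
      have "mu d (s 0) (s 2) p = mu d (t q 0) (t q 2) p" using q p by (intro mu_cong) auto
      \<comment> \<open>The stabilizer equation is known only at the test \<open>q\<close> itself
        and reaches \<open>p\<close> by domination. The factorizations of \<open>u\<close> and
        \<open>v\<close> hold exactly at every stage.\<close>
      also have "\<dots> = t q 0 p" using dominatesD[OF q(2) t(12)[OF q(1)] mu_closed[OF t(1)[OF q(1)] t(3)[OF q(1)]] t(1)[OF q(1)]] .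
      finally show "mu d (s 0) (s 2) p = s 0 p" using q(3) by simp
    qed (use sO in auto)
    show "cont A (s 2) = C" using cont_cong[of "t q0 2" "s 2", OF q0(2)] t(9)[OF q0(1)] by simp
    show "cont A (s 3) = C" using cont_cong[of "t q0 3" "s 3", OF q0(3)] t(10)[OF q0(1)] by simp
    show "cont A (s 4) = C" using cont_cong[of "t q0 4" "s 4", OF q0(4)] t(11)[OF q0(1)] by simp
  qed
qed

theorem equ_imp_pi_eq:
  "\<lbrakk>u \<in> Omega A; v \<in> Omega A; equ u v\<rbrakk> \<Longrightarrow> \<pi> u = \<pi> v"
proof (induction "card (cont A u)" arbitrary: u v rule: less_induct)
  case less
  define C where "C = cont A u"
  have finC: "finite C" unfolding C_def using cont_subset[OF less.prems(1)] finite_A by (rule finite_subset)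
  have IH: "\<pi> u = \<pi> v" if "u \<in> Omega A" "v \<in> Omega A" "equ u v" "cont A u \<subset> C" for u v
    using less.hyps[OF _ that(1-3)] psubset_card_mono[OF finC that(4)] by (simp add: C_def)
  have Cu: "cont A u = C" and Cv: "cont A v = C" using equ_cont[OF less.prems(3)] by (auto simp: C_def)
  show ?case
  proof (rule ccontr)
    assume neq: "\<pi> u \<noteq> \<pi> v"
    obtain x y z u1 v1 where l: "x \<in> Omega A" "y \<in> Omega A" "z \<in> Omega A" "u1 \<in> Omega A" "v1 \<in> Omega A"
      "u = mu True x u1" "v = mu True y v1" "\<pi> x = \<pi> y" "mu True x z = x"
      "cont A z = C" "cont A u1 = C" "cont A v1 = C"
      by (rule infinite_factorization[OF IH less.prems Cu neq])
    obtain x' y' z' u2 v2 where r: "x' \<in> Omega A" "y' \<in> Omega A" "z' \<in> Omega A" "u2 \<in> Omega A" "v2 \<in> Omega A"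
      "u = mu False x' u2" "v = mu False y' v2" "\<pi> x' = \<pi> y'" "mu False x' z' = x'"
      "cont A z' = C" "cont A u2 = C" "cont A v2 = C"
      by (rule infinite_factorization[OF IH less.prems Cu neq])
    \<comment> \<open>Idempotents of full content: \<open>E\<close> fixes the common prefix on its
      right, \<open>F\<close> the common suffix on its left.\<close>
    define E where "E = omega_pow A z"
    define F where "F = omega_pow A z'"
    have EF: "E \<in> Omega A" "F \<in> Omega A" "\<pi> E \<otimes> \<pi> E = \<pi> E" "\<pi> F \<otimes> \<pi> F = \<pi> F" "cont A E = C" "cont A F = C"
      using l r omega_pow_idem[OF l(3)] omega_pow_idem[OF r(3)]
        pi_mult[OF omega_pow_closed omega_pow_closed, OF l(3) l(3)]
        pi_mult[OF omega_pow_closed omega_pow_closed, OF r(3) r(3)]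
      by (auto simp: E_def F_def)
    have xE: "\<pi> x \<otimes> \<pi> E = \<pi> x" and Fx: "\<pi> F \<otimes> \<pi> x' = \<pi> x'"
      using arg_cong[OF mu_omega_pow[OF l(1,3,9)], of \<pi>] arg_cong[OF mu_omega_pow[OF r(1,3,9)], of \<pi>] l r
      by (simp_all add: pi_mu E_def F_def)
    \<comment> \<open>To be applied to both \<open>u\<close> and \<open>v\<close>. The prefixes of
      the two have equal images, and so have the suffixes, hence both elements have the same two
      ends.\<close>
    have "\<pi> w = \<pi> x \<otimes> \<pi> x'"
      if w: "w \<in> Omega A" "cont A w = C" "w1 \<in> Omega A" "cont A w1 = C" "w2 \<in> Omega A" "cont A w2 = C"
        "\<pi> w = \<pi> x \<otimes> \<pi> w1" "\<pi> w = \<pi> w2 \<otimes> \<pi> x'" for w w1 w2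
    proof (rule S.factorization_through_ends[OF _ _ _ _ _ _ _ w(7,8) xE Fx])
      show "\<pi> E \<otimes> \<pi> w1 \<otimes> \<pi> E = \<pi> E" using EF w by (intro absorb) auto
      show "\<pi> F \<otimes> \<pi> w2 \<otimes> \<pi> F = \<pi> F" using EF w by (intro absorb) auto
      show "\<pi> E \<otimes> (\<pi> F \<otimes> \<pi> w) \<otimes> \<pi> E = \<pi> E" using EF w absorb[OF EF(1,3), of "omult A F w"] by simp
    qed (use EF w l r in auto)
    note ends = this
    have "\<pi> u = \<pi> x \<otimes> \<pi> u1" "\<pi> v = \<pi> x \<otimes> \<pi> v1"
      using arg_cong[OF l(6), of \<pi>] arg_cong[OF l(7), of \<pi>] l(1-5,8) by (simp_all add: mu_def)
    moreover have "\<pi> u = \<pi> u2 \<otimes> \<pi> x'" "\<pi> v = \<pi> v2 \<otimes> \<pi> x'"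
      using arg_cong[OF r(6), of \<pi>] arg_cong[OF r(7), of \<pi>] r(1-5,8) by (simp_all add: mu_def)
    ultimately have "\<pi> u = \<pi> x \<otimes> \<pi> x'" "\<pi> v = \<pi> x \<otimes> \<pi> x'"
      using ends[OF less.prems(1) Cu l(4,11) r(4,11)] ends[OF less.prems(2) Cv l(5,12) r(5,12)] by blast+
    then have "\<pi> u = \<pi> v" by simp
    then show False using neq by simp
  qed
qed

end

section \<open>Substitution and provability\<close>

text \<open>The continuous homomorphism that extends \<open>\<sigma>\<close>. Its value at
  \<open>p\<close> is the value of \<open>w\<close> at the single test sending each letter
  \<open>b\<close> to \<open>\<sigma> b p\<close>, which makes continuity immediate.\<close>

definition subst :: "nat set \<Rightarrow> nat set \<Rightarrow> (nat \<Rightarrow> pw) \<Rightarrow> pw \<Rightarrow> pw" where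
  "subst B A \<sigma> w = (\<lambda>p\<in>tests A. w (fst p, \<lambda>b\<in>B. \<sigma> b p))"

context
  fixes A B :: "nat set" and \<sigma> :: "nat \<Rightarrow> pw"
  assumes \<sigma>: "\<And>b. b \<in> B \<Longrightarrow> \<sigma> b \<in> Omega A"
begin

lemma subst_test: "p \<in> tests A \<Longrightarrow> (fst p, \<lambda>b\<in>B. \<sigma> b p) \<in> tests B"
  using Omega_carrier[OF \<sigma>, of _ p] by (cases p) (auto simp: tests_iff)

lemma subst_apply: "p \<in> tests A \<Longrightarrow> subst B A \<sigma> w p = w (fst p, \<lambda>b\<in>B. \<sigma> b p)"
  by (simp add: subst_def)

lemma subst_closed:
  assumes w: "w \<in> Omega B"
  shows "subst B A \<sigma> w \<in> Omega A"
proof (rule OmegaI)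
  show "subst B A \<sigma> w \<in> extensional (tests A)" by (simp add: subst_def)
next
  fix T \<phi> assume t: "(T, \<phi>) \<in> tests A"
  show "subst B A \<sigma> w (T, \<phi>) \<in> carrier T"
    using Omega_carrier[OF w subst_test[OF t]] by (simp add: subst_apply[OF t])
next
  fix T \<phi> S h assume t: "(T, \<phi>) \<in> tests A" "fin_monoid S" "h \<in> mon_hom T S"
  have "restrict (h \<circ> (\<lambda>b\<in>B. \<sigma> b (T, \<phi>))) B = (\<lambda>b\<in>B. \<sigma> b (S, restrict (h \<circ> \<phi>) A))"
    using Omega_natural[OF \<sigma> t] by (intro restrict_ext) simp
  then show "h (subst B A \<sigma> w (T, \<phi>)) = subst B A \<sigma> w (S, restrict (h \<circ> \<phi>) A)"
    using Omega_natural[OF w _ t(2,3)] subst_test[OF t(1)]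
    by (simp add: subst_apply[OF t(1)] subst_apply[OF mon_hom_tests[OF t]])
qed

lemma subst_oone: "subst B A \<sigma> (oone B) = oone A"
proof (rule Omega_eqI)
  fix p assume p: "p \<in> tests A"
  show "subst B A \<sigma> (oone B) p = oone A p" using p subst_test[OF p] by (simp add: subst_apply)
qed (simp_all add: subst_closed)

lemma subst_omult:
  assumes "u \<in> Omega B" "v \<in> Omega B"
  shows "subst B A \<sigma> (omult B u v) = omult A (subst B A \<sigma> u) (subst B A \<sigma> v)"
proof (rule Omega_eqI)
  fix p assume p: "p \<in> tests A"
  show "subst B A \<sigma> (omult B u v) p = omult A (subst B A \<sigma> u) (subst B A \<sigma> v) p"
    using p subst_test[OF p] by (simp add: subst_apply)
qed (simp_all add: subst_closed assms)

lemma subst_gen: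
  assumes b: "b \<in> B"
  shows "subst B A \<sigma> (gen B b) = \<sigma> b"
proof (rule Omega_eqI)
  fix p assume p: "p \<in> tests A"
  show "subst B A \<sigma> (gen B b) p = \<sigma> b p" using p b subst_test[OF p] by (simp add: subst_apply)
qed (simp_all add: subst_closed b \<sigma>)

lemma subst_opow: "x \<in> Omega B \<Longrightarrow> subst B A \<sigma> (opow B x n) = opow A (subst B A \<sigma> x) n"
  by (induction n) (simp_all add: subst_oone subst_omult)

lemma subst_omega_pow:
  assumes x: "x \<in> Omega B"
  shows "subst B A \<sigma> (omega_pow B x) = omega_pow A (subst B A \<sigma> x)"
proof (rule Omega_eqI)
  fix p assume p: "p \<in> tests A"
  obtain m where "omega_pow B x (fst p, \<lambda>b\<in>B. \<sigma> b p) = opow B x (fact m) (fst p, \<lambda>b\<in>B. \<sigma> b p)"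
    "omega_pow A (subst B A \<sigma> x) p = opow A (subst B A \<sigma> x) (fact m) p"
    using omega_pow_apply2[OF x subst_closed[OF x] subst_test[OF p] p] .
  then show "subst B A \<sigma> (omega_pow B x) p = omega_pow A (subst B A \<sigma> x) p"
    using p by (simp add: subst_apply flip: subst_opow[OF x])
qed (simp_all add: subst_closed x)

lemma subst_cont_hom: "cont_hom B A (subst B A \<sigma>)"
  unfolding cont_hom_def
proof (intro conjI ballI)
  show "continuous_map (OmegaTop B) (OmegaTop A) (subst B A \<sigma>)"
  proof (rule continuous_map_OmegaTop)
    fix p assume p: "p \<in> tests A"
    show "\<exists>q\<in>tests B. \<forall>u\<in>Omega B. \<forall>w\<in>Omega B. w q = u q \<longrightarrow> subst B A \<sigma> w p = subst B A \<sigma> u p"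
      using subst_test[OF p] by (intro bexI[of _ "(fst p, \<lambda>b\<in>B. \<sigma> b p)"]) (simp_all add: subst_apply[OF p])
  qed (simp add: subst_closed)
qed (simp_all add: subst_oone subst_omult)

end

lemma closure_of_pairD:
  assumes "(u, v) \<in> prod_topology (OmegaTop A) (OmegaTop A) closure_of R"
  shows "u \<in> Omega A" "v \<in> Omega A"
    "p \<in> tests A \<Longrightarrow> \<exists>w\<in>Omega A. \<exists>z\<in>Omega A. (w, z) \<in> R \<and> w p = u p \<and> z p = v p"
proof -
  show uv: "u \<in> Omega A" "v \<in> Omega A" using assms by (auto simp: in_closure_of)
  assume p: "p \<in> tests A"
  let ?N = "{w \<in> Omega A. w p \<in> {u p}} \<times> {w \<in> Omega A. w p \<in> {v p}}"
  have "openin (prod_topology (OmegaTop A) (OmegaTop A)) ?N"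
    using openin_OmegaTop_eval[OF p] by (simp only: openin_prod_Times_iff) blast
  moreover have "(u, v) \<in> ?N" using uv by simp
  ultimately have "\<exists>y. y \<in> R \<and> y \<in> ?N"
    using assms[unfolded in_closure_of, THEN conjunct2, THEN spec, of ?N] by blast
  then show "\<exists>w\<in>Omega A. \<exists>z\<in>Omega A. (w, z) \<in> R \<and> w p = u p \<and> z p = v p" by auto
qed

text \<open>The neighbourhoods of the two components are governed by possibly different tests, and a
  test dominating both is used.\<close>

lemma closure_of_pairI:
  assumes uv: "u \<in> Omega A" "v \<in> Omega A"
    and R: "\<And>p. p \<in> tests A \<Longrightarrow> \<exists>w\<in>Omega A. \<exists>z\<in>Omega A. (w, z) \<in> R \<and> w p = u p \<and> z p = v p"
  shows "(u, v) \<in> prod_topology (OmegaTop A) (OmegaTop A) closure_of R"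
  unfolding in_closure_of
proof (intro conjI allI impI)
  fix N assume N: "(u, v) \<in> N \<and> openin (prod_topology (OmegaTop A) (OmegaTop A)) N"
  then obtain U V where UV: "openin (OmegaTop A) U" "openin (OmegaTop A) V" "u \<in> U" "v \<in> V" "U \<times> V \<subseteq> N"
    unfolding openin_prod_topology_alt by blast
  obtain p where p: "p \<in> tests A" "\<And>w. w \<in> Omega A \<Longrightarrow> w p = u p \<Longrightarrow> w \<in> U" using OmegaTop_nbhd[OF UV(1,3)] by blast
  obtain q where q: "q \<in> tests A" "\<And>w. w \<in> Omega A \<Longrightarrow> w q = v q \<Longrightarrow> w \<in> V" using OmegaTop_nbhd[OF UV(2,4)] by blast
  obtain r where r: "r \<in> tests A" "dominates A r p" "dominates A r q" using dominates_pair[OF p(1) q(1)] .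
  obtain w z where wz: "w \<in> Omega A" "z \<in> Omega A" "(w, z) \<in> R" "w r = u r" "z r = v r" using R[OF r(1)] by blast
  have "w \<in> U" using p(2)[OF wz(1)] dominatesD[OF r(2) wz(4,1) uv(1)] by blast
  moreover have "z \<in> V" using q(2)[OF wz(2)] dominatesD[OF r(3) wz(5,2) uv(2)] by blast
  ultimately show "\<exists>y. y \<in> R \<and> y \<in> N" using UV(5) wz(3) by blast
qed (use uv in simp)

lemma eval_mterm_closed: "(\<And>i. val i \<in> Omega A) \<Longrightarrow> eval_mterm A val t \<in> Omega A"
  by (induction t) auto

text \<open>Bounds the variables of a term, so that a fresh one can carry an additional
  factor.\<close>

primrec max_var :: "mterm \<Rightarrow> nat" where
  "max_var (MVar i) = i"
| "max_var MOne = 0"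
| "max_var (MMul s t) = max (max_var s) (max_var t)"

lemma eval_mterm_cong:
  "(\<And>i. i \<le> max_var t \<Longrightarrow> val i = val' i) \<Longrightarrow> eval_mterm A val t = eval_mterm A val' t"
  by (induction t) auto

lemma cont_hom_closed: "cont_hom B A f \<Longrightarrow> u \<in> Omega B \<Longrightarrow> f u \<in> Omega A"
  unfolding cont_hom_def using continuous_map_image_subset_topspace by fastforce

text \<open>Nonemptiness is the source of reflexivity: a trivial pair arises from some identity of
  the set placed in a term that ignores it.\<close>

locale provability = alphabet A for A +
  fixes \<Sigma> :: "pid set"
  assumes pids: "e \<in> \<Sigma> \<Longrightarrow> is_pid e" and nonempty: "\<Sigma> \<noteq> {}"
begin

text \<open>The induction principle for provability, with closedness expressed through single
  tests.\<close>

lemma Provable_least: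
  assumes "Sigma0 \<Sigma> A \<subseteq> R" "R O R \<subseteq> R"
    and "\<And>u v. \<lbrakk>u \<in> Omega A; v \<in> Omega A;
      \<And>p. p \<in> tests A \<Longrightarrow> \<exists>w\<in>Omega A. \<exists>z\<in>Omega A. (w, z) \<in> R \<and> w p = u p \<and> z p = v p\<rbrakk> \<Longrightarrow> (u, v) \<in> R"
  shows "Provable \<Sigma> A \<subseteq> R"
proof -
  have "prod_topology (OmegaTop A) (OmegaTop A) closure_of R \<subseteq> R"
  proof (rule subrelI)
    fix u v assume "(u, v) \<in> prod_topology (OmegaTop A) (OmegaTop A) closure_of R"
    from closure_of_pairD[OF this] show "(u, v) \<in> R" by (intro assms(3))
  qed
  then show ?thesis unfolding Provable_def using assms(1,2) by blast
qed

lemma Provable_Sigma0: "Sigma0 \<Sigma> A \<subseteq> Provable \<Sigma> A"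
  unfolding Provable_def by blast

lemma Provable_trans: "\<lbrakk>(u, v) \<in> Provable \<Sigma> A; (v, w) \<in> Provable \<Sigma> A\<rbrakk> \<Longrightarrow> (u, w) \<in> Provable \<Sigma> A"
  unfolding Provable_def by blast

lemma Provable_limit:
  assumes "u \<in> Omega A" "v \<in> Omega A"
    "\<And>p. p \<in> tests A \<Longrightarrow> \<exists>w\<in>Omega A. \<exists>z\<in>Omega A. (w, z) \<in> Provable \<Sigma> A \<and> w p = u p \<and> z p = v p"
  shows "(u, v) \<in> Provable \<Sigma> A"
  unfolding Provable_def
proof (rule InterI)
  fix R assume R: "R \<in> {R. Sigma0 \<Sigma> A \<subseteq> R \<and> R O R \<subseteq> R \<and> prod_topology (OmegaTop A) (OmegaTop A) closure_of R \<subseteq> R}"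
  then have "Provable \<Sigma> A \<subseteq> R" unfolding Provable_def by blast
  then have "(u, v) \<in> prod_topology (OmegaTop A) (OmegaTop A) closure_of R"
    using assms by (intro closure_of_pairI) blast+
  then show "(u, v) \<in> R" using R by blast
qed

lemma Sigma0_E:
  assumes "(x, y) \<in> Sigma0 \<Sigma> A"
  obtains B u v f t w where "(B, u, v) \<in> \<Sigma> \<or> (B, v, u) \<in> \<Sigma>" "cont_hom B A f" "\<And>i. w i \<in> Omega A"
    "f u \<in> Omega A" "f v \<in> Omega A"
    "x = eval_mterm A (w(0 := f u)) t" "y = eval_mterm A (w(0 := f v)) t"
proof -
  obtain B u v f t w where h: "(B, u, v) \<in> \<Sigma> \<or> (B, v, u) \<in> \<Sigma>" "cont_hom B A f" "\<And>i. w i \<in> Omega A"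
    "x = eval_mterm A (w(0 := f u)) t" "y = eval_mterm A (w(0 := f v)) t"
    using assms unfolding Sigma0_def by blast
  have "u \<in> Omega B" "v \<in> Omega B" using h(1) pids by (auto simp: is_pid_def)
  then show thesis using that[OF h(1-3) _ _ h(4,5)] cont_hom_closed[OF h(2)] by blast
qed

lemma Sigma0_I:
  "\<lbrakk>(B, u, v) \<in> \<Sigma> \<or> (B, v, u) \<in> \<Sigma>; cont_hom B A f; \<And>i. w i \<in> Omega A\<rbrakk>
    \<Longrightarrow> (eval_mterm A (w(0 := f u)) t, eval_mterm A (w(0 := f v)) t) \<in> Sigma0 \<Sigma> A"
  unfolding Sigma0_def by blast

lemma Provable_subset: "Provable \<Sigma> A \<subseteq> Omega A \<times> Omega A"
proof (rule Provable_least)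
  show "Sigma0 \<Sigma> A \<subseteq> Omega A \<times> Omega A"
  proof (rule subrelI)
    fix x y assume "(x, y) \<in> Sigma0 \<Sigma> A"
    then show "(x, y) \<in> Omega A \<times> Omega A"
      by (rule Sigma0_E) (auto intro!: eval_mterm_closed)
  qed
qed auto

lemma Provable_refl:
  assumes u: "u \<in> Omega A"
  shows "(u, u) \<in> Provable \<Sigma> A"
proof -
  obtain B x y where B: "(B, x, y) \<in> \<Sigma>" using nonempty by (metis all_not_in_conv surj_pair)
  have "cont_hom B A (subst B A (\<lambda>_. oone A))" by (rule subst_cont_hom) simp
  \<comment> \<open>The identity sits at variable 0, so the term \<open>MVar 1\<close> evaluates to
    \<open>u\<close> on both sides.\<close>
  from Sigma0_I[OF disjI1[OF B] this, where w = "\<lambda>_. u" and t = "MVar 1"] u show ?thesis using Provable_Sigma0 by auto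
qed

text \<open>The initial relation is symmetric by definition, and the converse of a closed transitive
  relation is again closed and transitive.\<close>

lemma Provable_sym:
  assumes "(u, v) \<in> Provable \<Sigma> A"
  shows "(v, u) \<in> Provable \<Sigma> A"
proof -
  have "Provable \<Sigma> A \<subseteq> (Provable \<Sigma> A)\<inverse>"
  proof (rule Provable_least)
    show "Sigma0 \<Sigma> A \<subseteq> (Provable \<Sigma> A)\<inverse>"
    proof (rule subrelI)
      fix x y assume "(x, y) \<in> Sigma0 \<Sigma> A"
      then show "(x, y) \<in> (Provable \<Sigma> A)\<inverse>"
      proof (rule Sigma0_E)
        fix B u v f t w
        assume h: "(B, u, v) \<in> \<Sigma> \<or> (B, v, u) \<in> \<Sigma>" "cont_hom B A f" "\<And>i. w i \<in> Omega A"
          "x = eval_mterm A (w(0 := f u)) t" "y = eval_mterm A (w(0 := f v)) t"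
        have "(B, v, u) \<in> \<Sigma> \<or> (B, u, v) \<in> \<Sigma>" using h(1) by blast
        from Sigma0_I[OF this h(2,3)] have "(y, x) \<in> Sigma0 \<Sigma> A" unfolding h(4,5) .
        then show ?thesis using Provable_Sigma0 by blast
      qed
    qed
    show "(Provable \<Sigma> A)\<inverse> O (Provable \<Sigma> A)\<inverse> \<subseteq> (Provable \<Sigma> A)\<inverse>" using Provable_trans by blast
  next
    fix u v assume uv: "u \<in> Omega A" "v \<in> Omega A"
      and h: "\<And>p. p \<in> tests A \<Longrightarrow> \<exists>w\<in>Omega A. \<exists>z\<in>Omega A. (w, z) \<in> (Provable \<Sigma> A)\<inverse> \<and> w p = u p \<and> z p = v p"
    have "(v, u) \<in> Provable \<Sigma> A"
      using h by (intro Provable_limit uv) blast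
    then show "(u, v) \<in> (Provable \<Sigma> A)\<inverse>" by simp
  qed
  then show ?thesis using assms by blast
qed

text \<open>Pairs that remain provable after multiplication by the fixed \<open>s\<close> form a
  closed transitive relation. It contains the initial one because terms can be multiplied by a
  further variable.\<close>

lemma Provable_context:
  assumes uv: "(u, v) \<in> Provable \<Sigma> A" and s: "s \<in> Omega A"
  shows "(omult A s u, omult A s v) \<in> Provable \<Sigma> A" "(omult A u s, omult A v s) \<in> Provable \<Sigma> A"
proof -
  define R where "R = {(u, v). u \<in> Omega A \<and> v \<in> Omega A \<and>
    (omult A s u, omult A s v) \<in> Provable \<Sigma> A \<and> (omult A u s, omult A v s) \<in> Provable \<Sigma> A}"
  have "Provable \<Sigma> A \<subseteq> R"
  proof (rule Provable_least)
    show "Sigma0 \<Sigma> A \<subseteq> R"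
    proof (rule subrelI)
      fix x y assume xy: "(x, y) \<in> Sigma0 \<Sigma> A"
      then show "(x, y) \<in> R"
      proof (rule Sigma0_E)
        fix B u v f t w
        assume h: "(B, u, v) \<in> \<Sigma> \<or> (B, v, u) \<in> \<Sigma>" "cont_hom B A f" "\<And>i. w i \<in> Omega A"
          "x = eval_mterm A (w(0 := f u)) t" "y = eval_mterm A (w(0 := f v)) t"
        \<comment> \<open>A variable outside \<open>t\<close> and different from 0, so neither
          \<open>t\<close> nor the substituted identity interferes with the value
          \<open>s\<close>.\<close>
        define k where "k = Suc (max_var t)"
        let ?w = "w(k := s)"
        have wO: "?w i \<in> Omega A" for i using h(3) s by simp
        have t: "eval_mterm A (?w(0 := z)) t = eval_mterm A (w(0 := z)) t"
          "eval_mterm A (?w(0 := z)) (MVar k) = s" for z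
          by (rule eval_mterm_cong) (auto simp: k_def)
        have "(omult A s x, omult A s y) \<in> Sigma0 \<Sigma> A" "(omult A x s, omult A y s) \<in> Sigma0 \<Sigma> A"
          using Sigma0_I[where w = ?w and t = "MMul (MVar k) t", OF h(1,2) wO]
            Sigma0_I[where w = ?w and t = "MMul t (MVar k)", OF h(1,2) wO]
          unfolding eval_mterm.simps(3) t h(4,5) by blast+
        then show ?thesis using Provable_Sigma0 Provable_subset xy unfolding R_def by blast
      qed
    qed
    show "R O R \<subseteq> R" unfolding R_def using Provable_trans by blast
  next
    fix u v assume uv: "u \<in> Omega A" "v \<in> Omega A"
      and h: "\<And>p. p \<in> tests A \<Longrightarrow> \<exists>w\<in>Omega A. \<exists>z\<in>Omega A. (w, z) \<in> R \<and> w p = u p \<and> z p = v p"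
    have "(omult A s u, omult A s v) \<in> Provable \<Sigma> A"
    proof (rule Provable_limit)
      fix p assume p: "p \<in> tests A"
      then obtain w z where "w \<in> Omega A" "z \<in> Omega A" "(w, z) \<in> R" "w p = u p" "z p = v p" using h by blast
      then show "\<exists>w\<in>Omega A. \<exists>z\<in>Omega A. (w, z) \<in> Provable \<Sigma> A \<and> w p = omult A s u p \<and> z p = omult A s v p"
        using s p by (intro bexI[of _ "omult A s w"] bexI[of _ "omult A s z"]) (auto simp: R_def)
    qed (use uv s in auto)
    moreover have "(omult A u s, omult A v s) \<in> Provable \<Sigma> A"
    proof (rule Provable_limit)
      fix p assume p: "p \<in> tests A"
      then obtain w z where "w \<in> Omega A" "z \<in> Omega A" "(w, z) \<in> R" "w p = u p" "z p = v p" using h by blast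
      then show "\<exists>w\<in>Omega A. \<exists>z\<in>Omega A. (w, z) \<in> Provable \<Sigma> A \<and> w p = omult A u s p \<and> z p = omult A v s p"
        using s p by (intro bexI[of _ "omult A w s"] bexI[of _ "omult A z s"]) (auto simp: R_def)
    qed (use uv s in auto)
    ultimately show "(u, v) \<in> R" using uv by (simp add: R_def)
  qed
  then show "(omult A s u, omult A s v) \<in> Provable \<Sigma> A" "(omult A u s, omult A v s) \<in> Provable \<Sigma> A"
    using uv by (auto simp: R_def)
qed

lemma Provable_instance:
  assumes "(B, u, v) \<in> \<Sigma>" "\<And>b. b \<in> B \<Longrightarrow> \<sigma> b \<in> Omega A"
  shows "(subst B A \<sigma> u, subst B A \<sigma> v) \<in> Provable \<Sigma> A"
proof -
  have "cont_hom B A (subst B A \<sigma>)" using assms(2) by (rule subst_cont_hom)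
  from Sigma0_I[OF disjI1[OF assms(1)] this, where w = "\<lambda>_. oone A" and t = "MVar 0"]
  show ?thesis using Provable_Sigma0 by auto
qed

section \<open>The quotient monoid by provability\<close>

definition cls :: "pw \<Rightarrow> pw set" where
  "cls u = {v. (u, v) \<in> Provable \<Sigma> A}"

definition quot :: "pw set monoid" where
  "quot = \<lparr>carrier = cls ` Omega A,
     mult = (\<lambda>X Y. cls (omult A (SOME u. u \<in> X) (SOME v. v \<in> Y))), one = cls (oone A)\<rparr>"

lemma cls_eq_iff:
  assumes "u \<in> Omega A" "v \<in> Omega A"
  shows "cls u = cls v \<longleftrightarrow> (u, v) \<in> Provable \<Sigma> A"
proof
  assume "cls u = cls v"
  then show "(u, v) \<in> Provable \<Sigma> A" using Provable_refl[OF assms(2)] by (auto simp: cls_def)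
next
  assume "(u, v) \<in> Provable \<Sigma> A"
  then show "cls u = cls v" unfolding cls_def using Provable_trans Provable_sym by blast
qed

lemma some_cls:
  assumes "u \<in> Omega A"
  shows "(SOME v. v \<in> cls u) \<in> Omega A" "(u, SOME v. v \<in> cls u) \<in> Provable \<Sigma> A"
proof -
  have "u \<in> cls u" using Provable_refl[OF assms] by (simp add: cls_def)
  then have "(SOME v. v \<in> cls u) \<in> cls u" by (rule someI[of "\<lambda>v. v \<in> cls u"])
  then show "(u, SOME v. v \<in> cls u) \<in> Provable \<Sigma> A" by (simp add: cls_def)
  then show "(SOME v. v \<in> cls u) \<in> Omega A" using Provable_subset by blast
qed

lemma quot_mult:
  assumes u: "u \<in> Omega A" and v: "v \<in> Omega A"
  shows "cls u \<otimes>\<^bsub>quot\<^esub> cls v = cls (omult A u v)"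
proof -
  note u' = some_cls[OF u] and v' = some_cls[OF v]
  have "(omult A u v, omult A (SOME w. w \<in> cls u) (SOME w. w \<in> cls v)) \<in> Provable \<Sigma> A"
    using Provable_trans[OF Provable_context(2)[OF u'(2) v] Provable_context(1)[OF v'(2) u'(1)]] .
  then show ?thesis using u v u'(1) v'(1) by (simp add: quot_def cls_eq_iff Provable_sym)
qed

lemma quot_closed_quotient: "closed_quotient A quot cls"
proof -
  have "monoid quot"
  proof (rule monoidI)
    show "\<one>\<^bsub>quot\<^esub> \<in> carrier quot" by (simp add: quot_def)
  next
    fix x assume "x \<in> carrier quot"
    then obtain u where u: "u \<in> Omega A" "x = cls u" by (auto simp: quot_def)
    have "\<one>\<^bsub>quot\<^esub> = cls (oone A)" by (simp add: quot_def)
    then show "\<one>\<^bsub>quot\<^esub> \<otimes>\<^bsub>quot\<^esub> x = x" "x \<otimes>\<^bsub>quot\<^esub> \<one>\<^bsub>quot\<^esub> = x" using u by (simp_all add: quot_mult)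
  next
    fix x y assume "x \<in> carrier quot" "y \<in> carrier quot"
    then obtain u v where "u \<in> Omega A" "v \<in> Omega A" "x = cls u" "y = cls v" by (auto simp: quot_def)
    moreover from this have "cls (omult A u v) \<in> carrier quot" by (simp add: quot_def)
    ultimately show "x \<otimes>\<^bsub>quot\<^esub> y \<in> carrier quot" by (simp add: quot_mult)
  next
    fix x y z assume "x \<in> carrier quot" "y \<in> carrier quot" "z \<in> carrier quot"
    then obtain u v w where "u \<in> Omega A" "v \<in> Omega A" "w \<in> Omega A" "x = cls u" "y = cls v" "z = cls w"
      by (auto simp: quot_def)
    then show "x \<otimes>\<^bsub>quot\<^esub> y \<otimes>\<^bsub>quot\<^esub> z = x \<otimes>\<^bsub>quot\<^esub> (y \<otimes>\<^bsub>quot\<^esub> z)"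
      by (simp add: quot_mult omult_assoc)
  qed
  then interpret S: monoid quot .
  show ?thesis
  proof unfold_locales
    show "carrier quot = cls ` Omega A" "cls (oone A) = \<one>\<^bsub>quot\<^esub>" by (simp_all add: quot_def)
  next
    fix u v assume "u \<in> Omega A" "v \<in> Omega A"
    then show "cls (omult A u v) = cls u \<otimes>\<^bsub>quot\<^esub> cls v" by (simp add: quot_mult)
  next
    fix u v assume uv: "u \<in> Omega A" "v \<in> Omega A"
      and h: "\<And>p. p \<in> tests A \<Longrightarrow> \<exists>w\<in>Omega A. \<exists>z\<in>Omega A. w p = u p \<and> z p = v p \<and> cls w = cls z"
    have "(u, v) \<in> Provable \<Sigma> A"
    proof (rule Provable_limit[OF uv])
      fix p assume "p \<in> tests A"
      then obtain w z where "w \<in> Omega A" "z \<in> Omega A" "w p = u p" "z p = v p" "cls w = cls z" using h by blast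
      then show "\<exists>w\<in>Omega A. \<exists>z\<in>Omega A. (w, z) \<in> Provable \<Sigma> A \<and> w p = u p \<and> z p = v p"
        using cls_eq_iff by blast
    qed
    then show "cls u = cls v" using uv by (simp add: cls_eq_iff)
  qed
qed

end

section \<open>The two bases\<close>

text \<open>\<open>gamma\<close> is the identity of \<open>GammaSet\<close> at an idempotent
  product, where the omega power disappears. Two applications give first \<open>e p a e = e\<close>
  and then that \<open>a e\<close> is idempotent. Multiplying the latter by \<open>e p\<close> on
  the left yields the claim.\<close>

lemma (in monoid) absorb_factor_of_gamma:
  assumes gamma: "\<And>e x y. \<lbrakk>e \<in> carrier G; x \<in> carrier G; y \<in> carrier G; e \<otimes> e = e; x \<otimes> y = e\<rbrakk>
      \<Longrightarrow> (e \<otimes> x) \<otimes> (e \<otimes> x) = e \<otimes> x"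
    and c: "e \<in> carrier G" "p \<in> carrier G" "a \<in> carrier G" "q \<in> carrier G"
    and e: "e \<otimes> e = e" "e = p \<otimes> a \<otimes> q"
  shows "e \<otimes> a \<otimes> e = e"
proof -
  have e': "p \<otimes> (a \<otimes> (q \<otimes> z)) = e \<otimes> z" if "z \<in> carrier G" for z
    using e(2) c that by (simp add: m_assoc)
  have ee: "e \<otimes> (e \<otimes> z) = e \<otimes> z" if "z \<in> carrier G" for z
    using e(1) c that by (simp add: m_assoc[symmetric])
  have paq: "p \<otimes> (a \<otimes> q) = e" using e(2) c by (simp add: m_assoc)
  \<comment> \<open>With \<open>x = e p a\<close> and \<open>y = q e\<close> the product is
    \<open>e (p a q) e = e\<close>. Multiplying the resulting equation by \<open>q\<close> on the
    right gives \<open>e p a e = e\<close>.\<close>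
  have "(e \<otimes> (e \<otimes> p \<otimes> a)) \<otimes> (e \<otimes> (e \<otimes> p \<otimes> a)) = e \<otimes> (e \<otimes> p \<otimes> a)"
    by (rule gamma[of e _ "q \<otimes> e"]) (simp_all add: c m_assoc e' ee e(1))
  then have "e \<otimes> (p \<otimes> (a \<otimes> (e \<otimes> (p \<otimes> a)))) = e \<otimes> (p \<otimes> a)"
    using c by (simp add: m_assoc ee)
  then have "(e \<otimes> (p \<otimes> (a \<otimes> (e \<otimes> (p \<otimes> a))))) \<otimes> q = (e \<otimes> (p \<otimes> a)) \<otimes> q" by simp
  then have epae: "e \<otimes> (p \<otimes> (a \<otimes> e)) = e" using c by (simp add: m_assoc paq e(1))
  have epae': "e \<otimes> (p \<otimes> (a \<otimes> (e \<otimes> z))) = e \<otimes> z" if "z \<in> carrier G" for z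
    using arg_cong[OF epae, of "\<lambda>w. w \<otimes> z"] c that by (simp add: m_assoc)
  \<comment> \<open>Here \<open>x = a e\<close> and \<open>y = e p\<close>. Their product
    \<open>a e p\<close> is idempotent by the previous equation, and its product with
    \<open>a e\<close> reduces to \<open>a e\<close>.\<close>
  have "(a \<otimes> e \<otimes> p \<otimes> (a \<otimes> e)) \<otimes> (a \<otimes> e \<otimes> p \<otimes> (a \<otimes> e)) = a \<otimes> e \<otimes> p \<otimes> (a \<otimes> e)"
    by (rule gamma[of _ _ "e \<otimes> p"]) (simp_all add: c m_assoc ee epae')
  then have "a \<otimes> (e \<otimes> (a \<otimes> e)) = a \<otimes> e" using c by (simp add: m_assoc epae epae')
  then have "e \<otimes> (p \<otimes> (a \<otimes> (e \<otimes> (a \<otimes> e)))) = e \<otimes> (p \<otimes> (a \<otimes> e))" by simp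
  then show ?thesis using c by (simp add: m_assoc epae epae')
qed

text \<open>Here \<open>e \<otimes> a \<otimes> e\<close> turns out to be a unit of the local monoid of \<open>e\<close>, which has
  no nontrivial units.\<close>

lemma (in monoid) absorb_factor_of_sigma:
  assumes regular: "\<And>e f x y. \<lbrakk>e \<in> carrier G; f \<in> carrier G; x \<in> carrier G; y \<in> carrier G;
      e \<otimes> e = e; f \<otimes> f = f; x \<otimes> y = e; y \<otimes> x = f\<rbrakk> \<Longrightarrow> e \<otimes> f \<otimes> e = e"
    and aperiodic: "\<And>e x y. \<lbrakk>e \<in> carrier G; x \<in> carrier G; y \<in> carrier G; y \<otimes> x = e; e \<otimes> x = x\<rbrakk> \<Longrightarrow> x = e"
    and c: "e \<in> carrier G" "p \<in> carrier G" "a \<in> carrier G" "q \<in> carrier G"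
    and e: "e \<otimes> e = e" "e = p \<otimes> a \<otimes> q"
  shows "e \<otimes> a \<otimes> e = e"
proof -
  have e': "p \<otimes> (a \<otimes> (q \<otimes> z)) = e \<otimes> z" if "z \<in> carrier G" for z
    using e(2) c that by (simp add: m_assoc)
  have ee: "e \<otimes> (e \<otimes> z) = e \<otimes> z" if "z \<in> carrier G" for z
    using e(1) c that by (simp add: m_assoc[symmetric])
  define s where "s = q \<otimes> (e \<otimes> p)"
  have s: "s \<in> carrier G" using c by (simp add: s_def)
  \<comment> \<open>The factorization \<open>e = (e p)(a q e)\<close>, combined with regularity,
    produces a right inverse \<open>s e\<close> of \<open>e a\<close>.\<close>
  have "e \<otimes> (a \<otimes> (q \<otimes> e) \<otimes> (e \<otimes> p)) \<otimes> e = e"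
    by (rule regular[of e _ "e \<otimes> p" "a \<otimes> (q \<otimes> e)"]) (simp_all add: c m_assoc e' ee e(1))
  then have ease: "e \<otimes> (a \<otimes> (s \<otimes> e)) = e" using c by (simp add: s_def m_assoc ee)
  have ease': "e \<otimes> (a \<otimes> (s \<otimes> (e \<otimes> z))) = e \<otimes> z" if "z \<in> carrier G" for z
    using arg_cong[OF ease, of "\<lambda>w. w \<otimes> z"] c s that by (simp add: m_assoc)
  \<comment> \<open>Applied to \<open>e = (e a)(s e)\<close>, regularity turns the right inverse
    into a left inverse \<open>e s e\<close> of \<open>e a e\<close>.\<close>
  have "e \<otimes> (s \<otimes> e \<otimes> (e \<otimes> a)) \<otimes> e = e"
    by (rule regular[of e _ "e \<otimes> a" "s \<otimes> e"]) (simp_all add: c s m_assoc ee ease ease' e(1))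
  then have esea: "e \<otimes> (s \<otimes> (e \<otimes> (a \<otimes> e))) = e" using c s by (simp add: m_assoc ee)
  then have "(e \<otimes> s \<otimes> e) \<otimes> (e \<otimes> a \<otimes> e) = e" using c s by (simp add: m_assoc ee)
  moreover have "e \<otimes> (e \<otimes> a \<otimes> e) = e \<otimes> a \<otimes> e" using c by (simp add: m_assoc ee)
  ultimately show ?thesis using c s by (intro aperiodic[of e "e \<otimes> a \<otimes> e" "e \<otimes> s \<otimes> e"]) auto
qed

text \<open>Since \<open>y x x = x\<close>, the idempotent \<open>e = y x\<close> equals the product
  of the omega powers of \<open>y\<close> and \<open>x\<close>. The second of these absorbs a
  further \<open>x\<close>, so \<open>e x = e\<close>.\<close>

lemma (in closed_quotient) aperiodic_units:
  assumes aper: "\<And>x. x \<in> Omega A \<Longrightarrow> \<pi> (omega_pow A x) \<otimes> \<pi> x = \<pi> (omega_pow A x)"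
    and c: "e \<in> carrier S" "x \<in> carrier S" "y \<in> carrier S" and e: "y \<otimes> x = e" "e \<otimes> x = x"
  shows "x = e"
proof -
  obtain u v where u: "u \<in> Omega A" "x = \<pi> u" and v: "v \<in> Omega A" "y = \<pi> v" using c by (auto simp: carrier_S)
  have "\<pi> (omega_pow A v) \<otimes> \<pi> (omega_pow A u) = e"
    using pi_omega_pow_prod[OF v(1) u(1)] e u v by simp
  then have "e \<otimes> x = \<pi> (omega_pow A v) \<otimes> (\<pi> (omega_pow A u) \<otimes> x)" using u v by (simp add: S.m_assoc[symmetric])
  also have "\<dots> = e" using aper[OF u(1)] pi_omega_pow_prod[OF v(1) u(1)] e u v by simp
  finally show ?thesis using e(2) by simp
qed

lemma XY_mem [simp]: "0 \<in> XY" "1 \<in> XY" "Suc 0 \<in> XY" and finite_XY: "finite XY"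
  by (simp_all add: XY_def)

lemma gxy_closed [simp]: "gx \<in> Omega XY" "gy \<in> Omega XY"
  by (simp_all add: gx_def gy_def)

lemma pids_Gamma: "e \<in> GammaSet \<Longrightarrow> is_pid e"
  by (simp add: GammaSet_def Let_def is_pid_def finite_XY)

lemma pids_Sigma: "e \<in> SigmaSet \<Longrightarrow> is_pid e"
  by (auto simp: SigmaSet_def is_pid_def finite_XY)

lemma subst_gxy:
  assumes "x \<in> Omega A" "y \<in> Omega A" "\<sigma> = (\<lambda>b. if b = 0 then x else y)"
  shows "subst XY A \<sigma> gx = x" "subst XY A \<sigma> gy = y"
  using subst_gen[of XY \<sigma> A 0] subst_gen[of XY \<sigma> A 1] assms by (simp_all add: gx_def gy_def)

lemma Gamma_absorbing:
  assumes "finite A"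
  shows "absorbing_quotient A (provability.quot A GammaSet) (provability.cls A GammaSet)"
proof -
  interpret provability A GammaSet
    using assms pids_Gamma by unfold_locales (auto simp: GammaSet_def Let_def)
  interpret C: closed_quotient A quot cls by (rule quot_closed_quotient)
  have gamma: "(e \<otimes>\<^bsub>quot\<^esub> x) \<otimes>\<^bsub>quot\<^esub> (e \<otimes>\<^bsub>quot\<^esub> x) = e \<otimes>\<^bsub>quot\<^esub> x"
    if h: "e \<in> carrier quot" "x \<in> carrier quot" "y \<in> carrier quot" "e \<otimes>\<^bsub>quot\<^esub> e = e" "x \<otimes>\<^bsub>quot\<^esub> y = e" for e x y
  proof -
    obtain u v where u: "u \<in> Omega A" "x = cls u" and v: "v \<in> Omega A" "y = cls v"
      using h by (auto simp: C.carrier_S)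
    define \<sigma> where "\<sigma> = (\<lambda>b::nat. if b = 0 then u else v)"
    have \<sigma>: "\<sigma> b \<in> Omega A" if "b \<in> XY" for b using u v by (simp add: \<sigma>_def)
    define z where "z = omult A (omega_pow A (omult A u v)) u"
    have "(subst XY A \<sigma> (omult XY (omult XY (omega_pow XY (omult XY gx gy)) gx) (omult XY (omega_pow XY (omult XY gx gy)) gx)),
        subst XY A \<sigma> (omult XY (omega_pow XY (omult XY gx gy)) gx)) \<in> Provable GammaSet A"
      using \<sigma> by (intro Provable_instance) (simp_all add: GammaSet_def Let_def)
    then have "(omult A z z, z) \<in> Provable GammaSet A"
      using subst_gxy[OF u(1) v(1) \<sigma>_def] by (simp add: subst_omult[OF \<sigma>] subst_omega_pow[OF \<sigma>] z_def)
    then have "cls (omult A z z) = cls z" using u v by (subst cls_eq_iff) (simp_all add: z_def)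
    \<comment> \<open>The product of \<open>u\<close> and \<open>v\<close> is idempotent modulo
      provability, so its omega power collapses to it.\<close>
    moreover have "cls (omega_pow A (omult A u v)) = cls (omult A u v)"
      using u v h by (intro C.pi_omega_pow_idem) auto
    ultimately show ?thesis using u v h by (simp add: z_def)
  qed
  show ?thesis
    by unfold_locales (rule C.S.absorb_factor_of_gamma[OF gamma])
qed

lemma Sigma_absorbing:
  assumes "finite A"
  shows "absorbing_quotient A (provability.quot A SigmaSet) (provability.cls A SigmaSet)"
proof -
  interpret provability A SigmaSet
    using assms pids_Sigma by unfold_locales (auto simp: SigmaSet_def)
  interpret C: closed_quotient A quot cls by (rule quot_closed_quotient)
  have aper: "cls (omega_pow A x) \<otimes>\<^bsub>quot\<^esub> cls x = cls (omega_pow A x)" if x: "x \<in> Omega A" for x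
  proof -
    \<comment> \<open>The aperiodicity identity involves one letter only. Both letters go to
      \<open>x\<close>, in the shape that \<open>subst_gxy\<close> expects.\<close>
    define \<sigma> where "\<sigma> = (\<lambda>b::nat. if b = 0 then x else x)"
    have \<sigma>: "\<sigma> b \<in> Omega A" if "b \<in> XY" for b using x by (simp add: \<sigma>_def)
    have "(subst XY A \<sigma> (omult XY (omega_pow XY gx) gx), subst XY A \<sigma> (omega_pow XY gx)) \<in> Provable SigmaSet A"
      using \<sigma> by (intro Provable_instance) (simp_all add: SigmaSet_def)
    then have "(omult A (omega_pow A x) x, omega_pow A x) \<in> Provable SigmaSet A"
      using subst_gxy[OF x x \<sigma>_def] by (simp add: subst_omult[OF \<sigma>] subst_omega_pow[OF \<sigma>])
    then have "cls (omult A (omega_pow A x) x) = cls (omega_pow A x)" using x by (subst cls_eq_iff) simp_all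
    then show ?thesis using x by simp
  qed
  have regular: "e \<otimes>\<^bsub>quot\<^esub> f \<otimes>\<^bsub>quot\<^esub> e = e"
    if h: "e \<in> carrier quot" "f \<in> carrier quot" "x \<in> carrier quot" "y \<in> carrier quot"
      "e \<otimes>\<^bsub>quot\<^esub> e = e" "f \<otimes>\<^bsub>quot\<^esub> f = f" "x \<otimes>\<^bsub>quot\<^esub> y = e" "y \<otimes>\<^bsub>quot\<^esub> x = f" for e f x y
  proof -
    obtain u v where u: "u \<in> Omega A" "x = cls u" and v: "v \<in> Omega A" "y = cls v"
      using h by (auto simp: C.carrier_S)
    define \<sigma> where "\<sigma> = (\<lambda>b::nat. if b = 0 then u else v)"
    have \<sigma>: "\<sigma> b \<in> Omega A" if "b \<in> XY" for b using u v by (simp add: \<sigma>_def)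
    define r s where "r = omega_pow A (omult A u v)" and "s = omega_pow A (omult A v u)"
    have "(subst XY A \<sigma> (omult XY (omult XY (omega_pow XY (omult XY gx gy)) (omega_pow XY (omult XY gy gx)))
         (omega_pow XY (omult XY gx gy))), subst XY A \<sigma> (omega_pow XY (omult XY gx gy))) \<in> Provable SigmaSet A"
      using \<sigma> by (intro Provable_instance) (simp_all add: SigmaSet_def)
    then have "(omult A (omult A r s) r, r) \<in> Provable SigmaSet A"
      using subst_gxy[OF u(1) v(1) \<sigma>_def] by (simp add: subst_omult[OF \<sigma>] subst_omega_pow[OF \<sigma>] r_def s_def)
    then have "cls (omult A (omult A r s) r) = cls r" using u v by (subst cls_eq_iff) (simp_all add: r_def s_def)
    moreover have "cls r = cls (omult A u v)" unfolding r_def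
      using u v h by (intro C.pi_omega_pow_idem) auto
    moreover have "cls s = cls (omult A v u)" unfolding s_def
      using u v h by (intro C.pi_omega_pow_idem) auto
    moreover have "r \<in> Omega A" "s \<in> Omega A" using u v by (simp_all add: r_def s_def)
    ultimately show ?thesis using u v h by simp
  qed
  show ?thesis
    by unfold_locales (rule C.S.absorb_factor_of_sigma[OF regular C.aperiodic_units[OF aper]])
qed

section \<open>The finite quotients satisfy both bases\<close>

text \<open>Continuity into a discrete space makes the images of the factorial powers eventually
  constant. The bound \<open>K\<close> keeps the exponent large enough for pumping.\<close>

lemma cont_hom_to_omega_pow:
  assumes h: "cont_hom_to B T h" and x: "x \<in> Omega B"
  obtains m where "m \<ge> K" "h (omega_pow B x) = h (opow B x (fact m))"
proof -
  have "continuous_map (OmegaTop B) (discrete_topology (carrier T)) h" using h by (simp add: cont_hom_to_def)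
  from continuous_map_limit[OF this omega_pow_limitin[OF x]]
  have lim: "limitin (discrete_topology (carrier T)) (h \<circ> (\<lambda>n. opow B x (fact n))) (h (omega_pow B x)) sequentially" .
  then have "h (omega_pow B x) \<in> carrier T" using limitin_topspace by fastforce
  then have "\<forall>\<^sub>F n in sequentially. h (opow B x (fact n)) \<in> {h (omega_pow B x)}"
    using lim[unfolded limitin_def o_def, THEN conjunct2, THEN spec, of "{h (omega_pow B x)}"] by simp
  then obtain m0 where "\<forall>m\<ge>m0. h (opow B x (fact m)) = h (omega_pow B x)"
    unfolding eventually_sequentially by auto
  then show thesis using that[of "max K m0"] by simp
qed

context alphabet
begin

lemma Q_hom_omega_pow:
  assumes h: "cont_hom_to B (Q A n) h" and x: "x \<in> Omega B" and w: "set w \<subseteq> A" "h x = code A n w"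
  obtains N where "N \<ge> K" "h (omega_pow B x) = code A n (lpow w N)"
proof -
  have pow: "h (opow B x k) = code A n (lpow w k)" for k
  proof (induction k)
    case 0
    then show ?case using h by (simp add: cont_hom_to_def Q_one)
  next
    case (Suc k)
    have "set (lpow w k) \<subseteq> A" using set_lpow w(1) by (rule subset_trans)
    then show ?case using h x w Suc by (simp add: cont_hom_to_def Q_mult)
  qed
  obtain m where "m \<ge> K" "h (omega_pow B x) = h (opow B x (fact m))" using cont_hom_to_omega_pow[OF h x] .
  moreover from this(1) have "fact m \<ge> K" using fact_ge_self[of m] by linarith
  ultimately show thesis using that pow by metis
qed

lemma Q_hom_code:
  assumes h: "cont_hom_to B (Q A n) h" and x: "x \<in> Omega B"
  obtains w where "set w \<subseteq> A" "h x = code A n w"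
proof -
  have "h x \<in> carrier (Q A n)"
    using h x continuous_map_image_subset_topspace[of "OmegaTop B" "discrete_topology (carrier (Q A n))" h]
    unfolding cont_hom_to_def by auto
  then show thesis using that Q_carrierE by metis
qed

text \<open>Leaves more than \<open>n\<close> copies on either side of an empty middle, as
  \<open>eqv_pump_pow\<close> requires.\<close>

lemma lpow_split:
  assumes "N \<ge> 2 * Suc n"
  obtains k l where "k > n" "l > n" "lpow w N = lpow w k @ [] @ lpow w l"
proof (rule that[of "Suc n" "N - Suc n"])
  show "lpow w N = lpow w (Suc n) @ [] @ lpow w (N - Suc n)"
    using lpow_add[of "Suc n" "N - Suc n" w] assms by (simp del: replicate.simps(2))
qed (use assms in auto)

lemma Q_models_Gamma: "Q A n \<in> models GammaSet"
proof -
  have "h (omult XY z z) = h z"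
    if h: "cont_hom_to XY (Q A n) h" and z: "z = omult XY (omega_pow XY (omult XY gx gy)) gx" for h z
  proof -
    obtain a where a: "set a \<subseteq> A" "h gx = code A n a" using Q_hom_code[OF h gxy_closed(1)] .
    obtain b where b: "set b \<subseteq> A" "h gy = code A n b" using Q_hom_code[OF h gxy_closed(2)] .
    have hm: "h (omult XY u v) = h u \<otimes>\<^bsub>Q A n\<^esub> h v" if "u \<in> Omega XY" "v \<in> Omega XY" for u v
      using h that by (simp add: cont_hom_to_def)
    let ?u = "a @ b"
    have u: "set ?u \<subseteq> A" "h (omult XY gx gy) = code A n ?u" using a b by (simp_all add: hm Q_mult)
    obtain N where N: "N \<ge> 2 * Suc n" "h (omega_pow XY (omult XY gx gy)) = code A n (lpow ?u N)"
      using Q_hom_omega_pow[OF h _ u] by auto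
    obtain k l where kl: "k > n" "l > n" "lpow ?u N = lpow ?u k @ [] @ lpow ?u l" using lpow_split[OF N(1)] .
    \<comment> \<open>The letters of \<open>a\<close> occur in \<open>a @ b\<close>, so
      \<open>a\<close> can be pumped away between the two powers. Appending \<open>a\<close> to both
      sides then gives the identity.\<close>
    have "eqv n (lpow ?u N @ a @ lpow ?u N) (lpow ?u N)"
      by (subst (3) kl(3)) (rule eqv_pump_pow; use N(1) kl in auto)
    then have "eqv n ((lpow ?u N @ a) @ (lpow ?u N @ a)) (lpow ?u N @ a)"
      using eqv_append_right[of n _ _ a] by fastforce
    moreover have "h z = code A n (lpow ?u N @ a)" unfolding z using N a u by (simp add: hm Q_mult)
    moreover have "set (lpow ?u N @ a) \<subseteq> A" using a u by simp
    ultimately show ?thesis using hm[of z z] code_eq_iff z by (simp add: Q_mult)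
  qed
  then show ?thesis using Q_fin_monoid by (simp add: models_def holds_in_def GammaSet_def Let_def)
qed

lemma Q_models_Sigma: "Q A n \<in> models SigmaSet"
proof -
  have "h (omult XY (omega_pow XY gx) gx) = h (omega_pow XY gx)"
    and "h (omult XY (omult XY (omega_pow XY (omult XY gx gy)) (omega_pow XY (omult XY gy gx)))
                   (omega_pow XY (omult XY gx gy))) = h (omega_pow XY (omult XY gx gy))"
    if h: "cont_hom_to XY (Q A n) h" for h
  proof -
    obtain a where a: "set a \<subseteq> A" "h gx = code A n a" using Q_hom_code[OF h gxy_closed(1)] .
    obtain b where b: "set b \<subseteq> A" "h gy = code A n b" using Q_hom_code[OF h gxy_closed(2)] .
    have hm: "h (omult XY u v) = h u \<otimes>\<^bsub>Q A n\<^esub> h v" if "u \<in> Omega XY" "v \<in> Omega XY" for u v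
      using h that by (simp add: cont_hom_to_def)
    obtain M where M: "M \<ge> 2 * Suc n" "h (omega_pow XY gx) = code A n (lpow a M)"
      using Q_hom_omega_pow[OF h _ a] by auto
    obtain k l where kl: "k > n" "l > n" "lpow a M = lpow a k @ [] @ lpow a l" using lpow_split[OF M(1)] .
    \<comment> \<open>The extra factor \<open>a\<close> is read as one more copy in the trailing
      power.\<close>
    have "eqv n (lpow a k @ [] @ lpow a (Suc l)) (lpow a k @ [] @ lpow a l)"
      using kl by (intro eqv_pump_pow) auto
    then have "eqv n (lpow a M @ a) (lpow a M)" unfolding kl(3) lpow_Suc_right by simp
    then show "h (omult XY (omega_pow XY gx) gx) = h (omega_pow XY gx)"
      using M a by (simp add: hm Q_mult code_eq_iff)
    let ?u = "a @ b" and ?v = "b @ a"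
    have u: "set ?u \<subseteq> A" "h (omult XY gx gy) = code A n ?u" and v: "set ?v \<subseteq> A" "h (omult XY gy gx) = code A n ?v"
      using a b by (simp_all add: hm Q_mult)
    obtain N where N: "N \<ge> 2 * Suc n" "h (omega_pow XY (omult XY gx gy)) = code A n (lpow ?u N)"
      using Q_hom_omega_pow[OF h _ u] by auto
    obtain L where L: "h (omega_pow XY (omult XY gy gx)) = code A n (lpow ?v L)"
      using Q_hom_omega_pow[OF h _ v] by auto
    obtain k l where kl: "k > n" "l > n" "lpow ?u N = lpow ?u k @ [] @ lpow ?u l" using lpow_split[OF N(1)] .
    \<comment> \<open>The inner power uses only letters of \<open>a @ b\<close>, whatever its
      exponent, so it is invisible between the outer powers.\<close>
    have "set (lpow ?v L) \<subseteq> set ?u" using set_lpow[of L ?v] by auto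
    then have "eqv n (lpow ?u N @ lpow ?v L @ lpow ?u N) (lpow ?u N)"
      by (subst (3) kl(3)) (rule eqv_pump_pow; use N(1) kl in auto)
    then show "h (omult XY (omult XY (omega_pow XY (omult XY gx gy)) (omega_pow XY (omult XY gy gx)))
        (omega_pow XY (omult XY gx gy))) = h (omega_pow XY (omult XY gx gy))"
      using N L u v by (simp add: hm Q_mult code_eq_iff)
  qed
  then show ?thesis using Q_fin_monoid by (simp add: models_def holds_in_def SigmaSet_def)
qed

lemma eval_Qtest_cont_hom: "cont_hom_to A (Q A n) (\<lambda>w. w (Qtest A n))"
  unfolding cont_hom_to_def
proof (intro conjI ballI)
  show "continuous_map (OmegaTop A) (discrete_topology (carrier (Q A n))) (\<lambda>w. w (Qtest A n))"
  proof (rule continuous_map_OmegaTop_discrete)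
    show "(\<lambda>w. w (Qtest A n)) \<in> Omega A \<rightarrow> carrier (Q A n)"
      using Omega_carrier[OF _ Qtest_tests[OF finite_A, of n]] by simp
    show "\<exists>p\<in>tests A. \<forall>w\<in>Omega A. w p = u p \<longrightarrow> w (Qtest A n) = u (Qtest A n)" for u :: pw
      by (intro bexI[of _ "Qtest A n"]) auto
  qed
qed simp_all

end

text \<open>Validity is tested only at the evaluations in the monoids \<open>Q A n\<close>. The
  absorbing property of the quotient then turns agreement at all levels into provability.\<close>

lemma h_strongI:
  assumes "\<And>e. e \<in> \<Sigma> \<Longrightarrow> is_pid e" "\<Sigma> \<noteq> {}"
    and absorbing: "\<And>A. finite A \<Longrightarrow> absorbing_quotient A (provability.quot A \<Sigma>) (provability.cls A \<Sigma>)"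
    and models: "\<And>A n. finite A \<Longrightarrow> Q A n \<in> models \<Sigma>"
  shows "h_strong \<Sigma>"
  unfolding h_strong_def
proof (intro allI impI)
  fix A u v
  assume A: "finite A" and uv: "u \<in> Omega A" "v \<in> Omega A" and holds: "\<forall>T\<in>models \<Sigma>. holds_in (A, u, v) T"
  interpret provability A \<Sigma> using A assms(1,2) by unfold_locales
  interpret absorbing_quotient A quot cls by (rule absorbing[OF A])
  have "u (Qtest A n) = v (Qtest A n)" for n
    using holds models[OF A, of n] eval_Qtest_cont_hom[of n] unfolding holds_in_def by auto
  then have "equ u v" by (simp add: equ_def)
  then have "cls u = cls v" using equ_imp_pi_eq uv by blast
  then show "(u, v) \<in> Provable \<Sigma> A" using cls_eq_iff uv by blast
qed

theorem theorem7p6: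
  shows "h_strong SigmaSet \<and> h_strong GammaSet"
proof
  show "h_strong SigmaSet"
    by (rule h_strongI[OF pids_Sigma _ Sigma_absorbing alphabet.Q_models_Sigma])
      (auto simp: SigmaSet_def intro: alphabet.intro)
  show "h_strong GammaSet"
    by (rule h_strongI[OF pids_Gamma _ Gamma_absorbing alphabet.Q_models_Gamma])
      (auto simp: GammaSet_def Let_def intro: alphabet.intro)
qed

end
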